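(* Let $k\ge 2$ be an integer and let $S$ be an arbitrary subset of $\mathbf{N}$. Then for real $x\ge 1$, $$\#\{(n_1,\dots,n_k)\in(\mathbf{N}\cap[1,x])^k : \operatorname{gcud}(n_1,\dots,n_k)\in S\}=\delta_k(S)\,x^k+V_k(x,S),$$ where $$\delta_k(S)=\sum_{n=1}^{\infty}\frac{\mu^*_S(n)\,\phi^k(n)}{n^{2k}},$$ and the remainder term satisfies: (1) $V_k(x,S)=O(x^{k-1})$ for $k>2$ and for arbitrary $S$; (2) $V_2(x,S)=O(x\log^4 x)$ for arbitrary $S$; (3) $V_2(x,S)=O(x\log^2 x)$ for every $S$ such that $\sum_{n\in S}\theta(n)/n<\infty$ (in particular for every finite $S$), and for every multiplicative $S$; (4) $V_2(x,S)=O(x)$ for every multiplicative $S$ such that $\sum_{p\notin S}1/p<\infty$, the sum being over primes $p$ not in $S$ (in particular if the set $\{p \text{ prime}: p\notin S\}$ is finite). Moreover, if $S$ is multiplicative, then $$\delta_k(S)=\prod_p\Bigl(1-\bigl(1-\tfrac1p\bigr)^k\sum_{a\ge 1,\ p^a\notin S}\frac{1}{p^{ak}}\Bigr),$$ and for $S=\{1\}$, $$\delta_k:=\delta_k(\{1\})=\prod_p\Bigl(1-\frac{(p-1)^k}{p^k(p^k-1)}\Bigr),$$ the products being over all primes $p$.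
   Context: For $d,n\in\mathbf{N}$, $d$ is a unitary divisor of $n$, written $d\| n$, if $d\mid n$ and $\gcd(d,n/d)=1$. $\operatorname{gcud}(n_1,\dots,n_k)$ denotes the greatest common unitary divisor of $n_1,\dots,n_k$ (the largest $d$ with $d\| n_i$ for all $i$). For $S\subseteq\mathbf{N}$, $\rho_S$ is its characteristic function, and $\mu^*_S$ is the function defined by $\sum_{d\| n}\mu^*_S(d)=\rho_S(n)$ for all $n\in\mathbf{N}$, equivalently $\mu^*_S(n)=\sum_{d\| n}\rho_S(d)(-1)^{\omega(n/d)}$, where $\omega(m)$ is the number of distinct prime factors of $m$. $\phi$ is Euler's totient function and $\theta(n)$ is the number of squarefree divisors of $n$. $S$ is called multiplicative if $1\in S$ and $\rho_S$ is a multiplicative function. *)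

theory Defs
  imports
    "HOL-Analysis.Analysis"
    "HOL-Number_Theory.Number_Theory"
    "HOL-Computational_Algebra.Squarefree"
    "HOL-Library.Landau_Symbols"
begin

text \<open>The natural numbers of the source are the positive integers; the values of the
  functions below at \<open>0\<close> play no role.\<close>

definition unitary_dvd :: "nat \<Rightarrow> nat \<Rightarrow> bool"  (infix \<open>udvd\<close> 50) where
  "d udvd n \<longleftrightarrow> d dvd n \<and> coprime d (n div d)"

definition gcud :: "nat set \<Rightarrow> nat" where
  "gcud A = Max {d. \<forall>n\<in>A. d udvd n}"

text \<open>The function \<open>mu_star S\<close> is the one determined by
  \<open>(\<Sum>d | d udvd n. mu_star S d) = indicator S n\<close> for all \<open>n > 0\<close>. Since \<open>n udvd n\<close>, this is
  solved recursively for the last term; see \<open>sum_mu_star\<close> and \<open>mu_star_unique\<close>.\<close>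

function mu_star :: "nat set \<Rightarrow> nat \<Rightarrow> real" where
  "mu_star S n = indicator S n - (\<Sum>d\<in>{d. d udvd n \<and> d < n}. mu_star S d)"
  by auto
termination by (relation "Wellfounded.measure snd") auto

declare mu_star.simps [simp del]

lemma udvd_decomp:
  assumes "n > 0"
  shows "{d. d udvd n} = insert n {d. d udvd n \<and> d < n}"
  using assms by (auto simp: unitary_dvd_def dest: dvd_imp_le)

lemma sum_mu_star:
  assumes "n > 0"
  shows "(\<Sum>d | d udvd n. mu_star S d) = indicator S n"
proof -
  have "finite {d. d udvd n \<and> d < n}"
    by (rule finite_subset[of _ "{..<n}"]) auto
  then show ?thesis
    unfolding udvd_decomp[OF assms] by (simp add: mu_star.simps[of S n])
qed

lemma mu_star_unique:
  assumes f: "\<And>n. n > 0 \<Longrightarrow> (\<Sum>d | d udvd n. f d) = indicator S n" and "n > 0"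
  shows "f n = mu_star S n"
  using \<open>n > 0\<close>
proof (induction n rule: less_induct)
  case (less n)
  have fin: "finite {d. d udvd n \<and> d < n}"
    by (rule finite_subset[of _ "{..<n}"]) auto
  have "f n + (\<Sum>d | d udvd n \<and> d < n. f d) = indicator S n"
    using f[OF less.prems] fin unfolding udvd_decomp[OF less.prems] by simp
  moreover have "(\<Sum>d | d udvd n \<and> d < n. f d) = (\<Sum>d | d udvd n \<and> d < n. mu_star S d)"
    using less.prems
    by (intro sum.cong refl less.IH) (auto simp: unitary_dvd_def intro: Nat.gr0I)
  ultimately show ?case
    by (simp add: mu_star.simps[of S n])
qed

definition theta :: "nat \<Rightarrow> nat" where
  "theta n = card {d. d dvd n \<and> squarefree d}"

definition multiplicative_set :: "nat set \<Rightarrow> bool" where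
  "multiplicative_set S \<longleftrightarrow> 1 \<in> S \<and>
     (\<forall>m n. m > 0 \<longrightarrow> n > 0 \<longrightarrow> coprime m n \<longrightarrow>
        (indicator S (m * n) :: real) = indicator S m * indicator S n)"

text \<open>A \<open>k\<close>-tuple is a list of length \<open>k\<close>.\<close>

definition gcud_count :: "nat \<Rightarrow> real \<Rightarrow> nat set \<Rightarrow> nat" where
  "gcud_count k x S =
     card {ns. length ns = k \<and> (\<forall>n\<in>set ns. 1 \<le> n \<and> real n \<le> x) \<and> gcud (set ns) \<in> S}"

definition delta_term :: "nat \<Rightarrow> nat set \<Rightarrow> nat \<Rightarrow> real" where
  "delta_term k S n = mu_star S n * real (totient n) ^ k / real n ^ (2 * k)"

text \<open>The index is shifted by \<open>Suc\<close> so that the series starts at \<open>n = 1\<close>.\<close>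

definition delta :: "nat \<Rightarrow> nat set \<Rightarrow> real" where
  "delta k S = (\<Sum>n. delta_term k S (Suc n))"

definition V :: "nat \<Rightarrow> real \<Rightarrow> nat set \<Rightarrow> real" where
  "V k x S = real (gcud_count k x S) - delta k S * x ^ k"

end

theory Submission
  imports Defs "HOL-Real_Asymp.Real_Asymp"
begin

text \<open>
  A number is a unitary divisor of the \<open>gcud\<close> iff it is a unitary divisor of every entry, so the
  count is \<open>\<Sum>d\<le>x. mu_star S d * N d ^ k\<close>, where \<open>N d\<close> counts the \<open>n \<le> x\<close> with \<open>d udvd n\<close>, i.e.
  the \<open>m \<le> x / d\<close> coprime to \<open>d\<close>. A sieve over the primes of \<open>d\<close> shows that \<open>N d\<close> is
  \<open>x * totient d / d\<^sup>2\<close> up to \<open>2 ^ \<omega>(d)\<close>, and the remainder is bounded by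
  \<open>k * x ^ (k - 1) * (\<Sum>d\<le>x. \<bar>mu_star S d\<bar> * 2 ^ \<omega>(d) / d ^ (k - 1))\<close> plus
  \<open>x ^ k * (\<Sum>d>x. \<bar>mu_star S d\<bar> / d ^ k)\<close>. The cases differ in the bound for \<open>mu_star\<close>:
  the number of divisors in general, the number of unitary divisors in \<open>S\<close> when
  \<open>\<Sum>n\<in>S. theta n / n\<close> converges, and \<open>1\<close> when \<open>S\<close> is multiplicative, where in addition
  \<open>mu_star S p = 0\<close> for primes \<open>p \<in> S\<close>. Sums over \<open>d\<close> are compared with powers of the harmonic
  sum by splitting \<open>d\<close> into factors, or with Euler products.
\<close>

subsection \<open>Unitary divisors\<close>

lemma udvd_trans:
  assumes "d udvd e" "e udvd n"
  shows "d udvd n"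
proof (cases "e = 0 \<or> d = 0")
  case True
  then show ?thesis using assms by (auto simp: unitary_dvd_def)
next
  case False
  from assms obtain a b where e: "e = d * a" and n: "n = e * b"
    unfolding unitary_dvd_def by (elim conjE dvdE)
  then have "coprime d a" "coprime (d * a) b"
    using assms False by (auto simp: unitary_dvd_def)
  then show ?thesis
    using False by (simp add: unitary_dvd_def e n mult.assoc)
qed

lemma div_dvd_div_left:
  fixes a b n :: nat
  assumes "a dvd b" "b dvd n"
  shows "n div b dvd n div a"
proof (cases "b = 0")
  case False
  obtain c d where b: "b = a * c" and n: "n = b * d" using assms by (elim dvdE)
  then have "n div b = d" "n div a = c * d" using False by (simp_all add: mult.assoc)
  then show ?thesis by simp
qed (use assms in auto)

text \<open>The cofactor of the lcm divides both \<open>n div d\<close> and \<open>n div e\<close>,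
  so it is coprime to \<open>d * e\<close>, which is a multiple of the lcm.\<close>

lemma lcm_udvd:
  assumes d: "d udvd n" and e: "e udvd n"
  shows "lcm d e udvd n"
proof -
  have l: "lcm d e dvd n" using d e by (simp add: unitary_dvd_def)
  have "n div lcm d e dvd n div d" "n div lcm d e dvd n div e"
    using l by (auto intro: div_dvd_div_left)
  then have "coprime d (n div lcm d e)" "coprime e (n div lcm d e)"
    using d e by (auto simp: unitary_dvd_def intro: coprime_divisors[OF dvd_refl])
  then have "coprime (d * e) (n div lcm d e)" by simp
  then have "coprime (lcm d e) (n div lcm d e)"
    using coprime_divisors[OF _ dvd_refl, of "lcm d e" "d * e"] by auto
  then show ?thesis using l by (simp add: unitary_dvd_def)
qed

lemma udvd_of_dvd:
  assumes "d udvd n" "e udvd n" "d dvd e" "n > 0"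
  shows "d udvd e"
proof -
  have "e div d dvd n div d"
    using assms by (auto simp: unitary_dvd_def elim!: dvdE)
  then show ?thesis
    using assms coprime_divisors[of d d "e div d" "n div d"] by (auto simp: unitary_dvd_def)
qed

lemma finite_udvd [simp]: "n > 0 \<Longrightarrow> finite {d. d udvd n}"
  by (rule finite_subset[of _ "{..n}"]) (auto simp: unitary_dvd_def dest: dvd_imp_le)

text \<open>Common unitary divisors are closed under lcm, so the one that is largest in size is a
  multiple of all the others; and divisibility between unitary divisors of one number is itself
  unitary. The maximum thus has the universal property that lets the sum defining
  \<open>mu_star\<close> be evaluated at the \<open>gcud\<close>.\<close>

lemma
  assumes "A \<noteq> {}" and pos: "\<And>n. n \<in> A \<Longrightarrow> n > 0"
  shows gcud_pos: "gcud A > 0"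
    and udvd_gcud_iff: "d udvd gcud A \<longleftrightarrow> (\<forall>n\<in>A. d udvd n)"
proof -
  obtain m where m: "m \<in> A" using assms by auto
  let ?D = "{d. \<forall>n\<in>A. d udvd n}"
  have fin: "finite ?D"
    by (rule finite_subset[OF _ finite_udvd[OF pos[OF m]]]) (use m in auto)
  have "1 \<in> ?D" by (auto simp: unitary_dvd_def)
  then have g: "gcud A \<in> ?D" unfolding gcud_def using Max_in[OF fin] by blast
  then show gpos: "gcud A > 0" using m pos[OF m] by (auto simp: unitary_dvd_def intro!: Nat.gr0I)
  show "d udvd gcud A \<longleftrightarrow> (\<forall>n\<in>A. d udvd n)"
  proof
    assume "d udvd gcud A"
    then show "\<forall>n\<in>A. d udvd n" using g by (blast intro: udvd_trans)
  next
    assume d: "\<forall>n\<in>A. d udvd n"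
    have "lcm d (gcud A) \<in> ?D" using d g pos by (auto intro: lcm_udvd)
    then have "lcm d (gcud A) \<le> gcud A" unfolding gcud_def by (rule Max_ge[OF fin])
    moreover have "d > 0"
      using d m pos[OF m] by (auto simp: unitary_dvd_def intro!: Nat.gr0I)
    ultimately have "lcm d (gcud A) = gcud A" using gpos
      by (metis dvd_imp_le dvd_lcm2 lcm_pos_nat le_antisym)
    then have "d dvd gcud A" by (metis dvd_lcm1)
    then show "d udvd gcud A" using udvd_of_dvd d g m pos by blast
  qed
qed

text \<open>A unitary divisor of \<open>n\<close> is determined by its set of primes \<open>P\<close>.\<close>

definition primary_part :: "nat \<Rightarrow> nat set \<Rightarrow> nat" where
  "primary_part n P = (\<Prod>p\<in>P. p ^ multiplicity p n)"

lemma multiplicity_primary_part: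
  assumes "P \<subseteq> prime_factors n" "prime p"
  shows "multiplicity p (primary_part n P) = (if p \<in> P then multiplicity p n else 0)"
proof -
  have "finite P" using assms(1) finite_subset by blast
  then show ?thesis
    unfolding primary_part_def using assms by (intro multiplicity_prod_prime_powers) auto
qed

lemma primary_part_pos:
  assumes "P \<subseteq> prime_factors n"
  shows "primary_part n P > 0"
  unfolding primary_part_def using assms
  by (intro prod_pos) (auto intro: prime_gt_0_nat)

lemma prime_factors_primary_part:
  assumes "P \<subseteq> prime_factors n"
  shows "prime_factors (primary_part n P) = P"
  using assms primary_part_pos[OF assms]
  by (auto simp: prime_factors_multiplicity multiplicity_primary_part[OF assms] split: if_splits)

text \<open>A prime of \<open>d\<close> does not divide the coprime cofactor, which therefore adds
  nothing to its exponent.\<close>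

lemma multiplicity_udvd:
  assumes "d udvd n" "n > 0" "p \<in> prime_factors d"
  shows "multiplicity p d = multiplicity p n"
proof -
  obtain e where n: "n = d * e" and "d > 0" using assms by (auto simp: unitary_dvd_def)
  then have "coprime d e" using assms by (simp add: unitary_dvd_def)
  then have "\<not> p dvd e" using assms(3)
    by (metis coprime_common_divisor in_prime_factors_imp_dvd in_prime_factors_imp_prime not_prime_unit)
  then show ?thesis
    using n assms \<open>d > 0\<close> prime_elem_multiplicity_mult_distrib[of p d e]
    by (auto simp: not_dvd_imp_multiplicity_0 dest: in_prime_factors_imp_prime)
qed

text \<open>The primary parts for complementary sets of primes multiply to \<open>n\<close> and
  share no prime.\<close>

lemma primary_part_udvd:
  assumes P: "P \<subseteq> prime_factors n" and n: "n > 0"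
  shows "primary_part n P udvd n"
proof -
  have "primary_part n P * primary_part n (prime_factors n - P) = primary_part n (prime_factors n)"
    unfolding primary_part_def using P by (subst prod.union_disjoint [symmetric]) (auto intro: prod.cong finite_subset)
  also have "\<dots> = n"
    unfolding primary_part_def using n prime_factorization_nat by (simp add: prime_factorization_nat[symmetric])
  finally have "n div primary_part n P = primary_part n (prime_factors n - P)"
    and "primary_part n P dvd n"
    using primary_part_pos[OF P] by (metis nonzero_mult_div_cancel_left less_not_refl, metis dvd_triv_left)
  moreover have "coprime (primary_part n P) (primary_part n (prime_factors n - P))"
    unfolding primary_part_def using P
    by (auto intro!: prod_coprime_left prod_coprime_right primes_coprime coprime_power_left_iff[THEN iffD2] coprime_power_right_iff[THEN iffD2] disjI1)
  ultimately show ?thesis by (simp add: unitary_dvd_def)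
qed

lemma bij_betw_prime_factors_udvd:
  assumes n: "n > 0"
  shows "bij_betw prime_factors {d. d udvd n} (Pow (prime_factors n))"
proof (rule bij_betw_byWitness[where f' = "primary_part n"])
  show "\<forall>d\<in>{d. d udvd n}. primary_part n (prime_factors d) = d"
  proof
    fix d assume "d \<in> {d. d udvd n}"
    then have d: "d udvd n" "d > 0" using n by (auto simp: unitary_dvd_def intro!: Nat.gr0I)
    have "primary_part n (prime_factors d) = (\<Prod>p\<in>prime_factors d. p ^ multiplicity p d)"
      unfolding primary_part_def using d n by (intro prod.cong) (auto simp: multiplicity_udvd)
    also have "\<dots> = d" using d prime_factorization_nat[of d] by simp
    finally show "primary_part n (prime_factors d) = d" .
  qed
  show "prime_factors ` {d. d udvd n} \<subseteq> Pow (prime_factors n)"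
    using n by (auto simp: unitary_dvd_def dest: dvd_prime_factors[rotated])
qed (use n in \<open>auto simp: prime_factors_primary_part primary_part_udvd\<close>)

text \<open>Since unitary divisors correspond to sets of primes of \<open>n\<close>, the left side
  is the right side multiplied out: a subset of the primes chooses the factors that contribute
  \<open>g\<close> instead of \<open>1\<close>.\<close>

lemma sum_udvd_prod:
  fixes g :: "nat \<Rightarrow> nat \<Rightarrow> 'a :: comm_semiring_1"
  assumes n: "n > 0"
  shows "(\<Sum>d | d udvd n. \<Prod>p\<in>prime_factors d. g p (multiplicity p d)) =
    (\<Prod>p\<in>prime_factors n. 1 + g p (multiplicity p n))"
proof -
  have "(\<Sum>d | d udvd n. \<Prod>p\<in>prime_factors d. g p (multiplicity p d)) =
      (\<Sum>d | d udvd n. \<Prod>p\<in>prime_factors d. g p (multiplicity p n))"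
    using n by (intro sum.cong prod.cong) (auto simp: multiplicity_udvd)
  also have "\<dots> = (\<Sum>P\<in>Pow (prime_factors n). \<Prod>p\<in>P. g p (multiplicity p n))"
    by (rule sum.reindex_bij_betw[OF bij_betw_prime_factors_udvd[OF n]])
  also have "\<dots> = (\<Prod>p\<in>prime_factors n. g p (multiplicity p n) + 1)"
    by (subst prod_add) auto
  finally show ?thesis by (simp add: add.commute)
qed

lemma card_udvd:
  assumes "n > 0"
  shows "card {d. d udvd n} = 2 ^ card (prime_factors n)"
  using bij_betw_same_card[OF bij_betw_prime_factors_udvd[OF assms]] by (simp add: card_Pow)

text \<open>The product of a set of primes of \<open>n\<close> is a squarefree divisor of
  \<open>n\<close>, and the set is recovered as the prime factors of that product.\<close>

lemma two_power_omega_le_theta: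
  assumes n: "n > 0"
  shows "2 ^ card (prime_factors n) \<le> theta n"
proof -
  have "card (Pow (prime_factors n)) \<le> card {d. d dvd n \<and> squarefree d}"
  proof (rule card_inj_on_le[where f = "\<Prod>"])
    have pf: "prime_factors (\<Prod>P) = P" if "P \<subseteq> prime_factors n" for P
    proof -
      have P: "finite P" "\<And>p. p \<in> P \<Longrightarrow> prime p" "0 \<notin> P"
        using that finite_subset[OF that] by auto
      then have "prime_factors (\<Prod>P) = (\<Union>p\<in>P. prime_factors p)"
        using prime_factors_prod[of P "\<lambda>p. p"] by (simp add: o_def)
      also have "\<dots> = P"
        using P by (auto simp: prime_prime_factors)
      finally show ?thesis .
    qed
    show "inj_on \<Prod> (Pow (prime_factors n))"
      using pf by (metis (mono_tags, lifting) Pow_iff inj_onI)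
    show "\<Prod> ` Pow (prime_factors n) \<subseteq> {d. d dvd n \<and> squarefree d}"
    proof safe
      fix P assume P: "P \<subseteq> prime_factors n"
      have "\<Prod>P dvd \<Prod>(prime_factors n)" using P by (intro prod_dvd_prod_subset) auto
      also have "\<dots> dvd primary_part n (prime_factors n)" unfolding primary_part_def
        using n by (intro prod_dvd_prod) (auto simp: prime_factors_multiplicity intro!: dvd_power)
      also have "\<dots> dvd n" using primary_part_udvd[OF order_refl n] by (simp add: unitary_dvd_def)
      finally show "\<Prod>P dvd n" .
      show "squarefree (\<Prod>P)"
        using P by (intro squarefree_prod_coprime) (auto intro: primes_coprime squarefree_prime)
    qed
    show "finite {d. d dvd n \<and> squarefree d}"
      by (rule finite_subset[of _ "{..n}"]) (use n in \<open>auto dest: dvd_imp_le\<close>)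
  qed
  then show ?thesis by (simp add: theta_def card_Pow)
qed

subsection \<open>Multiplicative functions and the unitary Moebius function\<close>

definition multiplicative_function :: "(nat \<Rightarrow> real) \<Rightarrow> bool" where
  "multiplicative_function f \<longleftrightarrow> f 1 = 1 \<and>
     (\<forall>m n. m > 0 \<longrightarrow> n > 0 \<longrightarrow> coprime m n \<longrightarrow> f (m * n) = f m * f n)"

lemma multiplicative_function_cong:
  assumes "\<And>n. n > 0 \<Longrightarrow> f n = g n"
  shows "multiplicative_function f = multiplicative_function g"
  using assms by (simp add: multiplicative_function_def)

lemma multiplicative_function_mult:
  "multiplicative_function f \<Longrightarrow> multiplicative_function g \<Longrightarrow>
    multiplicative_function (\<lambda>n. f n * g n)"
  by (simp add: multiplicative_function_def)

lemma multiplicative_function_abs: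
  "multiplicative_function f \<Longrightarrow> multiplicative_function (\<lambda>n. \<bar>f n\<bar>)"
  by (simp add: multiplicative_function_def abs_mult)

lemma multiplicative_function_divide:
  "multiplicative_function f \<Longrightarrow> multiplicative_function g \<Longrightarrow>
    multiplicative_function (\<lambda>n. f n / g n)"
  by (simp add: multiplicative_function_def)

lemma multiplicative_function_power:
  "multiplicative_function f \<Longrightarrow> multiplicative_function (\<lambda>n. f n ^ k)"
  by (simp add: multiplicative_function_def power_mult_distrib)

lemma multiplicative_function_of_nat: "multiplicative_function of_nat"
  by (simp add: multiplicative_function_def)

lemma multiplicative_function_totient: "multiplicative_function (\<lambda>n. real (totient n))"
  by (simp add: multiplicative_function_def totient_mult_coprime)

lemma multiplicative_function_indicator:
  "multiplicative_function (indicator S) \<longleftrightarrow> multiplicative_set S"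
  by (simp add: multiplicative_function_def multiplicative_set_def indicator_eq_1_iff)

text \<open>Coprime numbers have disjoint sets of primes, and each prime keeps its exponent in their
  product. Any choice of values at prime powers therefore extends to a multiplicative
  function.\<close>

lemma multiplicative_function_prod_prime_factors:
  "multiplicative_function (\<lambda>n. \<Prod>p\<in>prime_factors n. g p (multiplicity p n))"
proof -
  have "(\<Prod>p\<in>prime_factors (m * n). g p (multiplicity p (m * n))) =
      (\<Prod>p\<in>prime_factors m. g p (multiplicity p m)) * (\<Prod>p\<in>prime_factors n. g p (multiplicity p n))"
    if "m > 0" "n > 0" "coprime m n" for m n :: nat
  proof -
    have disj: "\<not> p dvd n" if "p \<in> prime_factors m" for p
      using that \<open>coprime m n\<close>
      by (metis coprime_common_divisor in_prime_factors_imp_dvd in_prime_factors_imp_prime not_prime_unit)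
    have disj': "\<not> p dvd m" if "p \<in> prime_factors n" for p
      using that disj[of p] \<open>m > 0\<close> by (auto simp: prime_factors_dvd)
    have "prime_factors (m * n) = prime_factors m \<union> prime_factors n"
      using that by (simp add: prime_factors_product)
    moreover have "prime_factors m \<inter> prime_factors n = {}"
      using disj by (auto dest: in_prime_factors_imp_dvd)
    moreover have "multiplicity p (m * n) = multiplicity p m" if "p \<in> prime_factors m" for p
      using that \<open>m > 0\<close> \<open>n > 0\<close> disj[OF that] prime_elem_multiplicity_mult_distrib[of p m n]
      by (auto simp: not_dvd_imp_multiplicity_0 dest: in_prime_factors_imp_prime)
    moreover have "multiplicity p (m * n) = multiplicity p n" if "p \<in> prime_factors n" for p
      using that \<open>m > 0\<close> \<open>n > 0\<close> disj'[OF that] prime_elem_multiplicity_mult_distrib[of p m n]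
      by (auto simp: not_dvd_imp_multiplicity_0 dest: in_prime_factors_imp_prime)
    ultimately show ?thesis by (simp add: prod.union_disjoint)
  qed
  then show ?thesis by (simp add: multiplicative_function_def)
qed

lemma multiplicative_function_two_power_omega:
  "multiplicative_function (\<lambda>n. 2 ^ card (prime_factors n))"
  using multiplicative_function_prod_prime_factors[of "\<lambda>_ _. 2"] by simp

text \<open>Prime powers are split off one at a time, each being coprime to the rest. The auxiliary
  claim allows arbitrary exponents, so that the induction on the set of primes does not have to
  change \<open>n\<close>.\<close>

lemma multiplicative_function_eq_prod:
  assumes f: "multiplicative_function f" and n: "n > 0"
  shows "f n = (\<Prod>p\<in>prime_factors n. f (p ^ multiplicity p n))"
proof -
  have *: "f (\<Prod>p\<in>P. p ^ m p) = (\<Prod>p\<in>P. f (p ^ m p))"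
    if "finite P" "\<And>p. p \<in> P \<Longrightarrow> prime p" for P and m :: "nat \<Rightarrow> nat"
    using that
  proof (induction P)
    case empty
    show ?case using f by (simp add: multiplicative_function_def)
  next
    case (insert q P)
    have "coprime (q ^ m q) (\<Prod>p\<in>P. p ^ m p)"
      using insert by (intro prod_coprime_right) (metis coprime_power_left_iff coprime_power_right_iff insertI1 insertI2 primes_coprime)
    moreover have "q ^ m q > 0" "(\<Prod>p\<in>P. p ^ m p) > 0"
      using insert.prems by (auto intro!: prod_pos simp: prime_gt_0_nat)
    ultimately have "f (q ^ m q * (\<Prod>p\<in>P. p ^ m p)) = f (q ^ m q) * f (\<Prod>p\<in>P. p ^ m p)"
      using f by (simp add: multiplicative_function_def)
    then show ?case using insert by simp
  qed
  show ?thesis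
    using *[of "prime_factors n" "\<lambda>p. multiplicity p n"] prime_factorization_nat[of n] n
    by auto
qed

text \<open>By uniqueness it is enough to sum the right side over the unitary divisors of
  \<open>n\<close>. Adding \<open>1\<close> to each factor leaves the product of the indicators at
  prime powers, which is \<open>indicator S n\<close>.\<close>

lemma mu_star_multiplicative:
  assumes S: "multiplicative_set S" and "n > 0"
  shows "mu_star S n = (\<Prod>p\<in>prime_factors n. indicator S (p ^ multiplicity p n) - 1)"
proof (rule mu_star_unique[symmetric, OF _ \<open>n > 0\<close>])
  fix n :: nat assume n: "n > 0"
  have "(\<Sum>d | d udvd n. \<Prod>p\<in>prime_factors d. indicator S (p ^ multiplicity p d) - 1) =
      (\<Prod>p\<in>prime_factors n. indicator S (p ^ multiplicity p n) :: real)"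
    using sum_udvd_prod[OF n, of "\<lambda>p a. indicator S (p ^ a) - 1 :: real"] by simp
  also have "\<dots> = indicator S n"
    using S n by (simp add: multiplicative_function_eq_prod multiplicative_function_indicator)
  finally show "(\<Sum>d | d udvd n. \<Prod>p\<in>prime_factors d. indicator S (p ^ multiplicity p d) - 1) =
      (indicator S n :: real)" .
qed

lemma multiplicative_function_mu_star:
  assumes "multiplicative_set S"
  shows "multiplicative_function (mu_star S)"
  using multiplicative_function_prod_prime_factors[of "\<lambda>p a. indicator S (p ^ a) - 1"]
  by (subst multiplicative_function_cong[OF mu_star_multiplicative[OF assms]])

lemma mu_star_prime_power:
  assumes "multiplicative_set S" "prime p" "a > 0"
  shows "mu_star S (p ^ a) = indicator S (p ^ a) - 1"
  using assms
  by (simp add: mu_star_multiplicative prime_factorization_prime_power prime_gt_0_nat)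

text \<open>Each factor of the product formula is \<open>0\<close> or \<open>-1\<close>. This gain
  over the general bound by the number of unitary divisors is what saves logarithms for
  multiplicative sets.\<close>

lemma abs_mu_star_multiplicative_le_1:
  assumes "multiplicative_set S" "n > 0"
  shows "\<bar>mu_star S n\<bar> \<le> 1"
proof -
  have "\<bar>mu_star S n\<bar> = (\<Prod>p\<in>prime_factors n. \<bar>indicator S (p ^ multiplicity p n) - 1\<bar>)"
    using assms by (simp add: mu_star_multiplicative abs_prod)
  also have "\<dots> \<le> 1" by (intro prod_le_1) (auto simp: indicator_def)
  finally show ?thesis .
qed

section \<open>Unitary Moebius inversion and the size of \<open>mu_star\<close>\<close>

text \<open>By uniqueness again: summing the right side over the unitary divisors of
  \<open>n\<close> and collecting the terms with the same argument of \<open>indicator S\<close>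
  leaves alternating sums that vanish except at \<open>n\<close> itself.\<close>

lemma mu_star_explicit:
  assumes "n > 0"
  shows "mu_star S n = (\<Sum>d | d udvd n. indicator S d * (-1) ^ card (prime_factors (n div d)))"
proof (rule mu_star_unique[symmetric, OF _ \<open>n > 0\<close>])
  fix n :: nat assume n: "n > 0"
  define r :: "nat \<Rightarrow> real" where "r d = (-1) ^ card (prime_factors d)" for d
  \<comment> \<open>The product formula gives a factor \<open>1 - 1\<close> for every prime of
    \<open>m\<close>; only the empty product at \<open>m = 1\<close> survives.\<close>
  have r: "(\<Sum>c | c udvd m. r c) = (if m = 1 then 1 else 0)" if "m > 0" for m
  proof -
    have "(\<Sum>c | c udvd m. r c) = (\<Prod>p\<in>prime_factors m. 0)"
      using sum_udvd_prod[OF that, of "\<lambda>_ _. -1 :: real"] by (simp add: r_def)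
    then show ?thesis using that by (auto simp: prime_factorization_empty_iff power_0_left)
  qed
  have pos: "d > 0" if "d udvd m" "m > 0" for d m
    using that by (auto simp: unitary_dvd_def intro!: Nat.gr0I)
  have "(\<Sum>d | d udvd n. \<Sum>e | e udvd d. indicator S e * r (d div e)) =
     (\<Sum>(d, e)\<in>(SIGMA d:{d. d udvd n}. {e. e udvd d}). indicator S e * r (d div e))"
    using n pos by (subst sum.Sigma) auto
  \<comment> \<open>A chain from \<open>e\<close> through \<open>d\<close> to \<open>n\<close>
    amounts to \<open>d = e * c\<close> with \<open>e\<close> a unitary divisor of \<open>n\<close>
    and \<open>c\<close> one of \<open>n div e\<close>.\<close>
  also have "\<dots> = (\<Sum>(e, c)\<in>(SIGMA e:{e. e udvd n}. {c. c udvd n div e}). indicator S e * r c)"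
  proof (rule sum.reindex_bij_witness[where i = "\<lambda>(e, c). (e * c, e)" and j = "\<lambda>(d, e). (e, d div e)"])
    fix x assume x: "x \<in> (SIGMA d:{d. d udvd n}. {e. e udvd d})"
    obtain d e where [simp]: "x = (d, e)" by (cases x)
    have "d udvd n" "e udvd d" using x by auto
    moreover from this obtain a b where ab: "d = e * a" "n = d * b"
      unfolding unitary_dvd_def by (elim conjE dvdE)
    ultimately have "e udvd n" "a udvd n div e"
      using n by (auto intro: udvd_trans simp: unitary_dvd_def mult.assoc)
    then show "(case x of (d, e) \<Rightarrow> (e, d div e)) \<in> (SIGMA e:{e. e udvd n}. {c. c udvd n div e})"
      and "(case case x of (d, e) \<Rightarrow> (e, d div e) of (e, c) \<Rightarrow> (e * c, e)) = x"
      using ab n by auto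
  next
    fix x assume x: "x \<in> (SIGMA e:{e. e udvd n}. {c. c udvd n div e})"
    obtain c e where [simp]: "x = (e, c)" by (cases x)
    have ec: "e udvd n" "c udvd n div e" using x by auto
    moreover from this obtain a b where ab: "n = e * a" "n div e = c * b"
      unfolding unitary_dvd_def by (elim conjE dvdE)
    ultimately have "n = e * (c * b)" using n by auto
    then have "e udvd e * c" "e * c udvd n"
      using n ec by (auto simp: unitary_dvd_def mult.assoc[symmetric])
    then show "(case x of (e, c) \<Rightarrow> (e * c, e)) \<in> (SIGMA d:{d. d udvd n}. {e. e udvd d})"
      and "(case case x of (e, c) \<Rightarrow> (e * c, e) of (d, e) \<Rightarrow> (e, d div e)) = x"
      using ab n by auto
  qed auto
  also have "\<dots> = (\<Sum>e | e udvd n. indicator S e * (\<Sum>c | c udvd n div e. r c))"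
    using n pos
    by (subst sum.Sigma[symmetric]) (auto simp: sum_distrib_left unitary_dvd_def dest: dvd_imp_le intro!: finite_udvd div_greater_zero_iff[THEN iffD2])
  also have "\<dots> = (\<Sum>e | e udvd n. if e = n then indicator S n else 0)"
  proof (rule sum.cong[OF refl])
    fix e assume "e \<in> {e. e udvd n}"
    then obtain a where "n = e * a" unfolding unitary_dvd_def by auto
    then show "indicator S e * (\<Sum>c | c udvd n div e. r c) = (if e = n then indicator S n else 0)"
      using n r[of a] by auto
  qed
  also have "\<dots> = indicator S n"
    using n by (simp add: unitary_dvd_def)
  finally show "(\<Sum>d | d udvd n. \<Sum>e | e udvd d. indicator S e * (-1) ^ card (prime_factors (d div e))) =
      (indicator S n :: real)" by (simp add: r_def)
qed

text \<open>The triangle inequality in the explicit formula. Counting only divisors in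
  \<open>S\<close> is what brings the convergence hypothesis on \<open>theta\<close> into
  play.\<close>

lemma abs_mu_star_le:
  assumes "n > 0"
  shows "\<bar>mu_star S n\<bar> \<le> real (card {d\<in>S. d udvd n})"
proof -
  have "\<bar>mu_star S n\<bar> \<le> (\<Sum>d | d udvd n. \<bar>indicator S d * (-1) ^ card (prime_factors (n div d))\<bar>)"
    unfolding mu_star_explicit[OF assms] by (rule sum_abs)
  also have "\<dots> = (\<Sum>d | d udvd n. indicator S d)"
    by (intro sum.cong) (auto simp: abs_mult power_abs indicator_def)
  also have "\<dots> = real (card {d\<in>S. d udvd n})"
    using assms by (simp add: indicator_def sum_of_bool_eq Int_def conj_commute)
  finally show ?thesis .
qed

lemma abs_mu_star_le_omega:
  assumes "n > 0"
  shows "\<bar>mu_star S n\<bar> \<le> 2 ^ card (prime_factors n)"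
proof -
  have "card {d\<in>S. d udvd n} \<le> card {d. d udvd n}"
    using assms by (intro card_mono) auto
  also have "\<dots> = 2 ^ card (prime_factors n)" by (rule card_udvd[OF assms])
  finally have "real (card {d\<in>S. d udvd n}) \<le> real (2 ^ card (prime_factors n))"
    by (rule of_nat_mono)
  then show ?thesis using abs_mu_star_le[OF assms, of S] unfolding of_nat_power of_nat_numeral by linarith
qed

section \<open>Sieve for the numbers with a given unitary divisor\<close>

lemma le_nat_floor_iff: "y \<ge> 0 \<Longrightarrow> m \<le> nat \<lfloor>y\<rfloor> \<longleftrightarrow> real m \<le> y"
  by (simp add: le_nat_iff le_floor_iff)

text \<open>Each prime of \<open>P\<close> doubles the number of roundings, hence the error \<open>2 ^ card P\<close>.\<close>

lemma sieve_count:
  assumes "finite P" "\<And>p. p \<in> P \<Longrightarrow> prime p" "y \<ge> 0"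
  shows "\<bar>real (card {m. 1 \<le> m \<and> real m \<le> y \<and> (\<forall>p\<in>P. \<not> p dvd m)}) - y * (\<Prod>p\<in>P. 1 - 1 / real p)\<bar>
    \<le> 2 ^ card P"
  using assms
proof (induction P arbitrary: y)
  case empty
  have "{m. 1 \<le> m \<and> real m \<le> y} = {1..nat \<lfloor>y\<rfloor>}"
    using \<open>y \<ge> 0\<close> by (auto simp: le_nat_floor_iff)
  then have "real (card {m. 1 \<le> m \<and> real m \<le> y}) = of_int \<lfloor>y\<rfloor>"
    using \<open>y \<ge> 0\<close> by simp
  then show ?case by simp linarith
next
  case (insert q P)
  define A where "A z = {m. 1 \<le> m \<and> real m \<le> z \<and> (\<forall>p\<in>P. \<not> p dvd m)}" for z
  have q: "prime q" "q > 0" using insert.prems by (auto intro: prime_gt_0_nat)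
  have fin: "finite (A z)" for z
    by (rule finite_subset[of _ "{..nat \<lfloor>z\<rfloor>}"]) (auto simp: A_def le_nat_floor)
  have ndvd: "\<not> p dvd q" if "p \<in> P" for p
    using that q insert by (metis insertCI primes_dvd_imp_eq)
  \<comment> \<open>No prime of \<open>P\<close> divides \<open>q\<close>, so multiplication by
    \<open>q\<close> preserves the sieve condition, and the multiples of \<open>q\<close> are
    counted by the same sieve at \<open>y / q\<close>.\<close>
  have img: "{m \<in> A y. q dvd m} = (*) q ` A (y / real q)"
  proof (intro equalityI subsetI)
    fix m assume "m \<in> {m \<in> A y. q dvd m}"
    then obtain j where "m = q * j" "m \<in> A y" by auto
    then show "m \<in> (*) q ` A (y / real q)"
      using q by (auto simp: A_def field_simps intro!: imageI)
  next
    fix m assume "m \<in> (*) q ` A (y / real q)"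
    then obtain j where "m = q * j" "j \<in> A (y / real q)" by auto
    then show "m \<in> {m \<in> A y. q dvd m}"
      using q ndvd insert.prems(1) by (auto simp: A_def field_simps prime_dvd_mult_iff Suc_le_eq)
  qed
  have "{m. 1 \<le> m \<and> real m \<le> y \<and> (\<forall>p\<in>insert q P. \<not> p dvd m)} = A y - {m \<in> A y. q dvd m}"
    by (auto simp: A_def)
  moreover have "card (A y - {m \<in> A y. q dvd m}) = card (A y) - card {m \<in> A y. q dvd m}"
    using fin by (intro card_Diff_subset) auto
  moreover have "card {m \<in> A y. q dvd m} \<le> card (A y)"
    using fin by (intro card_mono) auto
  moreover have "card {m \<in> A y. q dvd m} = card (A (y / real q))"
    unfolding img using q by (intro card_image) (auto simp: inj_on_def)
  ultimately have eq: "real (card {m. 1 \<le> m \<and> real m \<le> y \<and> (\<forall>p\<in>insert q P. \<not> p dvd m)}) =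
      real (card (A y)) - real (card (A (y / real q)))" by (simp add: of_nat_diff)
  have 1: "\<bar>real (card (A y)) - y * (\<Prod>p\<in>P. 1 - 1 / real p)\<bar> \<le> 2 ^ card P"
    unfolding A_def using insert.prems by (intro insert.IH) auto
  have 2: "\<bar>real (card (A (y / real q))) - y / real q * (\<Prod>p\<in>P. 1 - 1 / real p)\<bar> \<le> 2 ^ card P"
    unfolding A_def using insert.prems by (intro insert.IH) auto
  have "y * (\<Prod>p\<in>insert q P. 1 - 1 / real p) =
      y * (\<Prod>p\<in>P. 1 - 1 / real p) - y / real q * (\<Prod>p\<in>P. 1 - 1 / real p)"
    using insert.hyps by (simp add: algebra_simps)
  then show ?case using eq 1 2 insert.hyps by simp
qed

text \<open>With \<open>n = d * m\<close>, the condition says that \<open>m\<close> is coprime to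
  \<open>d\<close>, i.e. sifted by the primes of \<open>d\<close>, and the density of such
  \<open>m\<close> is \<open>totient d / d\<close>. The second, trivial bound serves as the common
  majorant when \<open>k\<close>-th powers are compared.\<close>

lemma udvd_count:
  assumes d: "d > 0" and x: "x \<ge> 0"
  shows "\<bar>real (card {n. 1 \<le> n \<and> real n \<le> x \<and> d udvd n}) - x * real (totient d) / real d ^ 2\<bar>
      \<le> 2 ^ card (prime_factors d)"
    and "real (card {n. 1 \<le> n \<and> real n \<le> x \<and> d udvd n}) \<le> x / real d"
proof -
  let ?A = "{m. 1 \<le> m \<and> real m \<le> x / real d \<and> (\<forall>p\<in>prime_factors d. \<not> p dvd m)}"
  have cop: "coprime d m \<longleftrightarrow> (\<forall>p\<in>prime_factors d. \<not> p dvd m)" for m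
  proof
    assume "coprime d m"
    then show "\<forall>p\<in>prime_factors d. \<not> p dvd m"
      by (metis coprime_common_divisor in_prime_factors_imp_dvd in_prime_factors_imp_prime not_prime_unit)
  next
    assume *: "\<forall>p\<in>prime_factors d. \<not> p dvd m"
    show "coprime d m"
    proof (rule ccontr)
      assume "\<not> coprime d m"
      then obtain p where "prime p" "p dvd gcd d m"
        using prime_factor_nat coprime_iff_gcd_eq_1 by blast
      then show False using * d by (auto simp: prime_factors_dvd)
    qed
  qed
  have "{n. 1 \<le> n \<and> real n \<le> x \<and> d udvd n} = (*) d ` ?A"
  proof (intro equalityI subsetI)
    fix n assume n: "n \<in> {n. 1 \<le> n \<and> real n \<le> x \<and> d udvd n}"
    then have "d dvd n" "coprime d (n div d)" by (simp_all add: unitary_dvd_def)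
    then obtain m where m: "n = d * m" "coprime d m" using d by (metis dvdE nonzero_mult_div_cancel_left less_not_refl)
    have "real m \<le> x / real d" using n d m by (simp add: field_simps)
    moreover have "1 \<le> m" using n d m by (cases m) simp_all
    ultimately have "m \<in> ?A" using m cop by simp
    then show "n \<in> (*) d ` ?A" unfolding m(1) by (rule imageI)
  next
    fix n assume "n \<in> (*) d ` ?A"
    then obtain m where m: "n = d * m" "1 \<le> m" "real m \<le> x / real d" "coprime d m"
      unfolding cop by auto
    have "real n \<le> x" using m d by (simp add: field_simps)
    then show "n \<in> {n. 1 \<le> n \<and> real n \<le> x \<and> d udvd n}"
      using m d by (simp add: unitary_dvd_def Suc_le_eq)
  qed
  moreover have "inj_on ((*) d) ?A" using d by (auto simp: inj_on_def)
  ultimately have eq: "card {n. 1 \<le> n \<and> real n \<le> x \<and> d udvd n} = card ?A"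
    by (simp add: card_image)
  have "x / real d * (\<Prod>p\<in>prime_factors d. 1 - 1 / real p) = x * real (totient d) / real d ^ 2"
    using d by (simp add: totient_formula2 power2_eq_square)
  then show "\<bar>real (card {n. 1 \<le> n \<and> real n \<le> x \<and> d udvd n}) - x * real (totient d) / real d ^ 2\<bar>
      \<le> 2 ^ card (prime_factors d)"
    using sieve_count[of "prime_factors d" "x / real d"] x eq by auto
  have "card ?A \<le> card {1..nat \<lfloor>x / real d\<rfloor>}"
    by (intro card_mono) (auto simp: le_nat_floor)
  also have "real (card {1..nat \<lfloor>x / real d\<rfloor>}) \<le> x / real d" using x by simp
  finally show "real (card {n. 1 \<le> n \<and> real n \<le> x \<and> d udvd n}) \<le> x / real d"
    unfolding eq by simp
qed

subsection \<open>Counting tuples\<close>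

text \<open>The indicator at the \<open>gcud\<close> is replaced by the sum of
  \<open>mu_star\<close> over its unitary divisors, and the sums are interchanged: \<open>d\<close>
  then occurs once for each tuple with all entries having \<open>d\<close> as a unitary divisor.
  Such \<open>d\<close> do not exceed the entries, so the sum stops at the floor of
  \<open>x\<close>.\<close>

lemma gcud_count_eq_sum:
  assumes k: "k \<ge> 1" and x: "x \<ge> 0"
  shows "real (gcud_count k x S) =
    (\<Sum>d = 1..nat \<lfloor>x\<rfloor>. mu_star S d * real (card {n. 1 \<le> n \<and> real n \<le> x \<and> d udvd n}) ^ k)"
proof -
  define N where "N = nat \<lfloor>x\<rfloor>"
  define X where "X = {ns. set ns \<subseteq> {1..N} \<and> length ns = k}"
  have N: "n \<in> {1..N} \<longleftrightarrow> 1 \<le> n \<and> real n \<le> x" for n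
    using x by (auto simp: N_def le_nat_floor_iff)
  have fin: "finite X" unfolding X_def by (rule finite_lists_length_eq) simp
  have "{ns. length ns = k \<and> (\<forall>n\<in>set ns. 1 \<le> n \<and> real n \<le> x) \<and> gcud (set ns) \<in> S} =
      X \<inter> {ns. gcud (set ns) \<in> S}"
    unfolding X_def using N by auto
  then have "real (gcud_count k x S) = (\<Sum>ns\<in>X. indicator S (gcud (set ns)))"
    using fin by (simp add: gcud_count_def indicator_def sum_of_bool_eq)
  also have "\<dots> = (\<Sum>ns\<in>X. \<Sum>d = 1..N. if \<forall>n\<in>set ns. d udvd n then mu_star S d else 0)"
  proof (rule sum.cong[OF refl])
    fix ns assume ns: "ns \<in> X"
    then have "set ns \<noteq> {}" and pos: "\<And>n. n \<in> set ns \<Longrightarrow> n > 0"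
      using k by (auto simp: X_def)
    note gcud = gcud_pos[OF this] udvd_gcud_iff[OF this]
    obtain m where m: "m \<in> set ns" using \<open>set ns \<noteq> {}\<close> by (metis ex_in_conv)
    have "{d. d udvd gcud (set ns)} = {d \<in> {1..N}. \<forall>n\<in>set ns. d udvd n}"
    proof (intro equalityI subsetI)
      fix d assume "d \<in> {d. d udvd gcud (set ns)}"
      then have d: "\<forall>n\<in>set ns. d udvd n" by (simp add: gcud)
      then have "d dvd m" using m by (simp add: unitary_dvd_def)
      then have "d \<le> m" "d > 0" using pos[OF m] by (auto intro: dvd_imp_le Nat.gr0I)
      moreover have "m \<le> N" using ns m by (auto simp: X_def)
      ultimately show "d \<in> {d \<in> {1..N}. \<forall>n\<in>set ns. d udvd n}" using d by simp
    qed (simp add: gcud)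
    then have "indicator S (gcud (set ns)) = sum (mu_star S) {d \<in> {1..N}. \<forall>n\<in>set ns. d udvd n}"
      using sum_mu_star[OF gcud(1), of S] by simp
    then show "indicator S (gcud (set ns)) =
        (\<Sum>d = 1..N. if \<forall>n\<in>set ns. d udvd n then mu_star S d else 0)"
      by (simp only: sum.inter_filter[OF finite_atLeastAtMost])
  qed
  also have "\<dots> = (\<Sum>d = 1..N. \<Sum>ns\<in>X. if \<forall>n\<in>set ns. d udvd n then mu_star S d else 0)"
    by (rule sum.swap)
  also have "\<dots> = (\<Sum>d = 1..N. mu_star S d * real (card {n. 1 \<le> n \<and> real n \<le> x \<and> d udvd n}) ^ k)"
  proof (rule sum.cong[OF refl])
    fix d
    let ?A = "{n. 1 \<le> n \<and> real n \<le> x \<and> d udvd n}"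
    have "{ns \<in> X. \<forall>n\<in>set ns. d udvd n} = {ns. set ns \<subseteq> ?A \<and> length ns = k}"
      unfolding X_def subset_iff N by auto
    moreover have "finite ?A"
      by (rule finite_subset[of _ "{1..N}"]) (unfold subset_iff N, auto)
    ultimately have "card {ns \<in> X. \<forall>n\<in>set ns. d udvd n} = card ?A ^ k"
      by (simp add: card_lists_length_eq)
    then show "(\<Sum>ns\<in>X. if \<forall>n\<in>set ns. d udvd n then mu_star S d else 0) = mu_star S d * real (card ?A) ^ k"
      using fin by (simp add: sum.inter_filter[symmetric])
  qed
  finally show ?thesis by (simp add: N_def)
qed

section \<open>The remainder as a main sum and a tail\<close>

lemma abs_power_diff_le:
  fixes a b M :: real
  assumes "0 \<le> a" "a \<le> M" "0 \<le> b" "b \<le> M"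
  shows "\<bar>a ^ k - b ^ k\<bar> \<le> real k * \<bar>a - b\<bar> * M ^ (k - 1)"
proof (induction k)
  case (Suc k)
  have "a ^ Suc k - b ^ Suc k = a * (a ^ k - b ^ k) + (a - b) * b ^ k"
    by (simp add: algebra_simps)
  then have "\<bar>a ^ Suc k - b ^ Suc k\<bar> \<le> a * \<bar>a ^ k - b ^ k\<bar> + \<bar>a - b\<bar> * b ^ k"
    using assms by (simp add: abs_mult order.trans[OF abs_triangle_ineq])
  also have "\<dots> \<le> M * (real k * \<bar>a - b\<bar> * M ^ (k - 1)) + \<bar>a - b\<bar> * M ^ k"
    using assms Suc by (intro add_mono mult_mono power_mono) auto
  \<comment> \<open>For \<open>k = 0\<close> the truncated exponent \<open>k - 1\<close> is harmless
    because of the factor \<open>real k\<close>.\<close>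
  also have "\<dots> = real (Suc k) * \<bar>a - b\<bar> * M ^ k"
    by (cases k) (simp_all add: algebra_simps)
  finally show ?case by simp
qed simp

text \<open>Translates the shifted series defining \<open>delta\<close> into an unordered sum over
  the positive integers, where tails can be split off and terms rearranged.\<close>

lemma suminf_Suc_eq_infsum:
  fixes f :: "nat \<Rightarrow> real"
  assumes "f summable_on {0<..}"
  shows "summable (\<lambda>n. f (Suc n))" "(\<Sum>n. f (Suc n)) = infsum f {0<..}"
proof -
  have "bij_betw Suc UNIV {0<..}"
    by (rule bij_betwI[of _ _ _ "\<lambda>n. n - 1"]) auto
  then have "((\<lambda>n. f (Suc n)) has_sum infsum f {0<..}) UNIV"
    using has_sum_infsum[OF assms] by (simp add: has_sum_reindex_bij_betw)
  then show "summable (\<lambda>n. f (Suc n))" "(\<Sum>n. f (Suc n)) = infsum f {0<..}"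
    using has_sum_imp_sums sums_iff by blast+
qed

lemma summable_on_abs_imp:
  fixes f :: "'a \<Rightarrow> real"
  shows "(\<lambda>x. \<bar>f x\<bar>) summable_on A \<Longrightarrow> f summable_on A"
  using summable_on_iff_abs_summable_on_real[of f A] by simp

lemma abs_delta_term_le: "\<bar>delta_term k S d\<bar> \<le> \<bar>mu_star S d\<bar> / real d ^ k"
proof (cases "d = 0")
  case True
  then show ?thesis by (cases k) (simp_all add: delta_term_def)
next
  case False
  have "\<bar>delta_term k S d\<bar> = \<bar>mu_star S d\<bar> * (real (totient d) ^ k / real d ^ (2 * k))"
    by (simp add: delta_term_def abs_mult)
  also have "\<dots> \<le> \<bar>mu_star S d\<bar> * (real d ^ k / real d ^ (2 * k))"
    by (intro mult_left_mono divide_right_mono power_mono) (simp_all add: totient_le)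
  also have "\<dots> = \<bar>mu_star S d\<bar> / real d ^ k"
    using False by (simp add: mult_2 power_add)
  finally show ?thesis .
qed

lemma delta_term_summable:
  assumes "(\<lambda>d. \<bar>mu_star S d\<bar> / real d ^ k) summable_on {0<..}"
  shows "(\<lambda>d. \<bar>delta_term k S d\<bar>) summable_on {0<..}"
  using assms by (rule summable_on_comparison_test) (auto simp: abs_delta_term_le)

text \<open>The density series is cut at the floor of \<open>x\<close>. Below the cut, count and
  approximation are compared term by term; above it the count has no terms, and the tail of the
  series is estimated absolutely.\<close>

lemma V_bound:
  assumes k: "k \<ge> 1" and x: "x \<ge> 0"
    and summ: "(\<lambda>d. \<bar>mu_star S d\<bar> / real d ^ k) summable_on {0<..}"
  shows "\<bar>V k x S\<bar> \<le>
    real k * x ^ (k - 1) * (\<Sum>d = 1..nat \<lfloor>x\<rfloor>. \<bar>mu_star S d\<bar> * 2 ^ card (prime_factors d) / real d ^ (k - 1))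
    + x ^ k * infsum (\<lambda>d. \<bar>mu_star S d\<bar> / real d ^ k) {nat \<lfloor>x\<rfloor><..}"
proof -
  define N where "N = nat \<lfloor>x\<rfloor>"
  define c where "c d = real (card {n. 1 \<le> n \<and> real n \<le> x \<and> d udvd n})" for d
  have abs: "(\<lambda>d. \<bar>delta_term k S d\<bar>) summable_on {0<..}" by (rule delta_term_summable[OF summ])
  then have summ': "delta_term k S summable_on {0<..}"
    by (rule summable_on_abs_imp)
  have sub: "delta_term k S summable_on {N<..}" "(\<lambda>d. \<bar>delta_term k S d\<bar>) summable_on {N<..}"
      "(\<lambda>d. \<bar>mu_star S d\<bar> / real d ^ k) summable_on {N<..}"
    by (rule summable_on_subset_banach[OF summ'] summable_on_subset_banach[OF abs]
      summable_on_subset_banach[OF summ]; force)+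
  have "{0<..} = {1..N} \<union> {N<..}" by auto
  then have "delta k S = infsum (delta_term k S) ({1..N} \<union> {N<..})"
    using suminf_Suc_eq_infsum[OF summ'] by (simp add: delta_def)
  also have "\<dots> = (\<Sum>d = 1..N. delta_term k S d) + infsum (delta_term k S) {N<..}"
    using sub by (subst infsum_Un_disjoint) auto
  finally have delta: "delta k S = (\<Sum>d = 1..N. delta_term k S d) + infsum (delta_term k S) {N<..}" .
  have "V k x S = (\<Sum>d = 1..N. mu_star S d * c d ^ k) - delta k S * x ^ k"
    using gcud_count_eq_sum[OF k x] by (simp add: V_def N_def c_def)
  also have "\<dots> = (\<Sum>d = 1..N. mu_star S d * c d ^ k - delta_term k S d * x ^ k)
      - x ^ k * infsum (delta_term k S) {N<..}"
    unfolding delta sum_subtractf by (simp add: algebra_simps sum_distrib_left)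
  finally have "\<bar>V k x S\<bar> \<le> \<bar>\<Sum>d = 1..N. mu_star S d * c d ^ k - delta_term k S d * x ^ k\<bar>
      + x ^ k * \<bar>infsum (delta_term k S) {N<..}\<bar>"
    using x by (simp add: abs_triangle_ineq4[THEN order_trans] abs_mult)
  also have "\<bar>\<Sum>d = 1..N. mu_star S d * c d ^ k - delta_term k S d * x ^ k\<bar> \<le>
      (\<Sum>d = 1..N. \<bar>mu_star S d * c d ^ k - delta_term k S d * x ^ k\<bar>)"
    by (rule sum_abs)
  also have "(\<Sum>d = 1..N. \<bar>mu_star S d * c d ^ k - delta_term k S d * x ^ k\<bar>) \<le>
    (\<Sum>d = 1..N. real k * x ^ (k - 1) * (\<bar>mu_star S d\<bar> * 2 ^ card (prime_factors d) / real d ^ (k - 1)))"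
  proof (rule sum_mono)
    fix d assume "d \<in> {1..N}"
    then have d: "d > 0" by simp
    let ?b = "x * real (totient d) / real d ^ 2"
    have c: "\<bar>c d - ?b\<bar> \<le> 2 ^ card (prime_factors d)" "c d \<le> x / real d"
      using udvd_count[OF d x] by (simp_all add: c_def)
    \<comment> \<open>Count and approximation both lie between \<open>0\<close> and
      \<open>x / d\<close>, so passing to \<open>k\<close>-th powers multiplies the error by at most
      \<open>k * (x / d) ^ (k - 1)\<close>.\<close>
    have b: "0 \<le> ?b" "?b \<le> x / real d"
      using x d by (simp_all add: power2_eq_square field_simps mult_left_mono totient_le)
    have "delta_term k S d * x ^ k = mu_star S d * ?b ^ k"
      by (simp add: delta_term_def power_divide power_mult_distrib power_mult)
    then have "\<bar>mu_star S d * c d ^ k - delta_term k S d * x ^ k\<bar> = \<bar>mu_star S d\<bar> * \<bar>c d ^ k - ?b ^ k\<bar>"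
      by (simp add: right_diff_distrib flip: abs_mult)
    also have "\<dots> \<le> \<bar>mu_star S d\<bar> * (real k * \<bar>c d - ?b\<bar> * (x / real d) ^ (k - 1))"
      using c b by (intro mult_left_mono abs_power_diff_le) (auto simp: c_def)
    also have "\<dots> \<le> \<bar>mu_star S d\<bar> * (real k * 2 ^ card (prime_factors d) * (x / real d) ^ (k - 1))"
      using c x by (intro mult_left_mono mult_right_mono) auto
    finally show "\<bar>mu_star S d * c d ^ k - delta_term k S d * x ^ k\<bar> \<le>
      real k * x ^ (k - 1) * (\<bar>mu_star S d\<bar> * 2 ^ card (prime_factors d) / real d ^ (k - 1))"
      by (simp add: power_divide mult_ac)
  qed
  also have "\<bar>infsum (delta_term k S) {N<..}\<bar> \<le> infsum (\<lambda>d. \<bar>delta_term k S d\<bar>) {N<..}"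
    using norm_infsum_bound[of "delta_term k S" "{N<..}"] sub by simp
  also have "\<dots> \<le> infsum (\<lambda>d. \<bar>mu_star S d\<bar> / real d ^ k) {N<..}"
    using sub by (intro infsum_mono) (auto simp: abs_delta_term_le)
  finally show ?thesis using x by (simp add: N_def sum_distrib_left mult_left_mono)
qed

subsection \<open>Divisor sums\<close>

lemma summable_on_greaterThan_bound:
  fixes f :: "nat \<Rightarrow> real"
  assumes nonneg: "\<And>n. n > M \<Longrightarrow> f n \<ge> 0" and bound: "\<And>N. sum f {M<..N} \<le> C"
  shows "f summable_on {M<..}" "infsum f {M<..} \<le> C"
proof -
  have fin: "sum f F \<le> C" if "finite F" "F \<subseteq> {M<..}" for F
  proof -
    \<comment> \<open>Inserting \<open>0\<close> makes \<open>Max\<close> meaningful for empty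
      \<open>F\<close>.\<close>
    have "F \<subseteq> {M<..Max (insert 0 F)}" using that by auto
    then have "sum f F \<le> sum f {M<..Max (insert 0 F)}"
      using nonneg by (intro sum_mono2) auto
    then show ?thesis using bound order_trans by blast
  qed
  show summ: "f summable_on {M<..}"
    using fin nonneg by (intro nonneg_bdd_above_summable_on) (auto intro!: bdd_aboveI)
  show "infsum f {M<..} \<le> C"
    using fin by (intro infsum_le_finite_sums[OF summ])
qed

text \<open>Induction; the step is \<open>ln t \<le> t - 1\<close> at
  \<open>t = N / Suc N\<close>.\<close>

lemma sum_inverse_le_ln:
  assumes "N \<ge> 1"
  shows "(\<Sum>n = 1..N. 1 / real n) \<le> 1 + ln (real N)"
  using assms
proof (induction N rule: dec_induct)
  case (step N)
  have "ln (real N / real (Suc N)) \<le> real N / real (Suc N) - 1"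
    using step by (intro ln_le_minus_one) simp
  also have "\<dots> = - (1 / real (Suc N))" by (simp add: field_simps)
  finally have "ln (real N) - ln (real (Suc N)) \<le> - (1 / real (Suc N))"
    using step by (simp add: ln_div)
  then show ?case using step by simp
qed simp

lemma sum_inverse_square_tail:
  "(\<Sum>n\<in>{M<..N}. 1 / real n ^ 2) \<le> 2 / (real M + 1)"
proof (cases "M < N")
  case True
  then have "Suc M \<le> N" by simp
  \<comment> \<open>The subtracted term \<open>1 / real N\<close> lets the induction telescope with
    \<open>1 / (N * Suc N)\<close>.\<close>
  then have "(\<Sum>n\<in>{M<..N}. 1 / real n ^ 2) \<le> 2 / (real M + 1) - 1 / real N"
  proof (induction N rule: dec_induct)
    case base
    have "1 / (real M + 1) ^ 2 \<le> 1 / (real M + 1)"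
      by (intro divide_left_mono self_le_power) simp_all
    moreover have "{M<..Suc M} = {Suc M}" by auto
    ultimately show ?case by (simp add: add.commute)
  next
    case (step N)
    have "N > 0" using step by simp
    have "1 / real (Suc N) ^ 2 \<le> 1 / (real N * real (Suc N))"
      unfolding power2_eq_square using \<open>N > 0\<close> by (intro divide_left_mono mult_right_mono) auto
    also have "\<dots> = 1 / real N - 1 / real (Suc N)" using \<open>N > 0\<close> by (simp add: field_simps)
    finally have "1 / real (Suc N) ^ 2 \<le> 1 / real N - 1 / real (Suc N)" .
    moreover have "{M<..Suc N} = insert (Suc N) {M<..N}" using step by auto
    ultimately show ?case using step.IH by simp
  qed
  then show ?thesis by (rule order_trans) simp
qed simp

abbreviation divisor_count :: "nat \<Rightarrow> real" where
  "divisor_count n \<equiv> real (card {d. d dvd n})"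

lemma sum_divisor_count_eq:
  fixes g :: "nat \<Rightarrow> real"
  assumes "finite A" "\<And>n. n \<in> A \<Longrightarrow> n > 0"
  shows "(\<Sum>n\<in>A. divisor_count n * g n) = (\<Sum>(n, d)\<in>(SIGMA n:A. {d. d dvd n}). g n)"
  using assms by (subst sum.Sigma[symmetric]) auto

text \<open>With \<open>n = a * b\<close> one has \<open>b > M div a\<close>, and the tail over
  \<open>b\<close> is at most \<open>2 / (M div a + 1)\<close>. For \<open>a \<le> M\<close> this is
  at most \<open>2 * a / M\<close>, which leaves a harmonic sum; for \<open>a > M\<close> the
  quotient is \<open>0\<close>, and the inverse squares of \<open>a\<close> form another tail of
  order \<open>1 / M\<close>.\<close>

lemma sum_divisor_count_tail:
  assumes "M \<ge> 1"
  shows "(\<Sum>n\<in>{M<..N}. divisor_count n / real n ^ 2) \<le>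
    (2 * (\<Sum>n = 1..M. 1 / real n) + 4) / real M"
proof -
  have "(\<Sum>n\<in>{M<..N}. divisor_count n / real n ^ 2) =
      (\<Sum>(n, d)\<in>(SIGMA n:{M<..N}. {d. d dvd n}). 1 / real n ^ 2)"
    using sum_divisor_count_eq[of "{M<..N}" "\<lambda>n. 1 / real n ^ 2"] by simp
  also have "\<dots> \<le> (\<Sum>(a, b)\<in>(SIGMA a:{1..N}. {M div a<..N}). 1 / real a ^ 2 * (1 / real b ^ 2))"
  proof (rule sum_le_included[where i = "\<lambda>(a, b). (a * b, a)"])
    show "\<forall>s\<in>(SIGMA n:{M<..N}. {d. d dvd n}). \<exists>t\<in>(SIGMA a:{1..N}. {M div a<..N}).
        (case t of (a, b) \<Rightarrow> (a * b, a)) = s \<and>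
        (case s of (n, d) \<Rightarrow> 1 / real n ^ 2) \<le> (case t of (a, b) \<Rightarrow> 1 / real a ^ 2 * (1 / real b ^ 2))"
    proof safe
      fix n d assume n: "n \<in> {M<..N}" and "d dvd n"
      then obtain e where e: "n = d * e" by auto
      have "d > 0" "e > 0" using n e by (auto intro!: Nat.gr0I)
      then have "d \<le> n" "e \<le> n" using e by simp_all
      moreover have "M < n" "n \<le> N" using n by simp_all
      ultimately have "d \<le> N" "e \<le> N" "M < e * d" using e by (simp_all only: mult.commute)
      then have "(d, e) \<in> (SIGMA a:{1..N}. {M div a<..N})"
        using \<open>d > 0\<close> by (simp add: div_less_iff_less_mult)
      then show "\<exists>t\<in>(SIGMA a:{1..N}. {M div a<..N}). (case t of (a, b) \<Rightarrow> (a * b, a)) = (n, d) \<and>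
          1 / real n ^ 2 \<le> (case t of (a, b) \<Rightarrow> 1 / real a ^ 2 * (1 / real b ^ 2))"
        by (rule bexI[rotated]) (simp add: e power_mult_distrib)
    qed
  qed (auto intro: finite_subset[of _ "SIGMA n:{M<..N}. {..n}"] dest: dvd_imp_le)
  also have "\<dots> = (\<Sum>a = 1..N. 1 / real a ^ 2 * (\<Sum>b\<in>{M div a<..N}. 1 / real b ^ 2))"
    by (subst sum.Sigma[symmetric]) (simp_all add: sum_distrib_left)
  also have "\<dots> \<le> (\<Sum>a = 1..N. 1 / real a ^ 2 * (2 / (real (M div a) + 1)))"
    by (intro sum_mono mult_left_mono sum_inverse_square_tail) simp
  also have "\<dots> \<le> (\<Sum>a\<in>{1..M} \<union> {M<..N}. 1 / real a ^ 2 * (2 / (real (M div a) + 1)))"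
    by (rule sum_mono2) auto
  also have "\<dots> = (\<Sum>a = 1..M. 1 / real a ^ 2 * (2 / (real (M div a) + 1)))
      + (\<Sum>a\<in>{M<..N}. 1 / real a ^ 2 * 2)"
    by (subst sum.union_disjoint) auto
  also have "\<dots> \<le> (\<Sum>a = 1..M. 2 / real M * (1 / real a)) + 4 / real M"
  proof (rule add_mono)
    show "(\<Sum>a = 1..M. 1 / real a ^ 2 * (2 / (real (M div a) + 1))) \<le> (\<Sum>a = 1..M. 2 / real M * (1 / real a))"
    proof (rule sum_mono)
      fix a assume a: "a \<in> {1..M}"
      have "M < a * (M div a + 1)" using a mod_less_divisor[of a M]
        by (metis add.commute atLeastAtMost_iff dividend_less_times_div less_le_trans mult_Suc_right plus_1_eq_Suc zero_less_one)
      then have "real M \<le> real a * (real (M div a) + 1)"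
        by (metis of_nat_1 of_nat_add of_nat_le_iff of_nat_mult less_imp_le)
      then have "2 / (real (M div a) + 1) \<le> 2 * real a / real M"
        using a assms by (simp add: field_simps)
      then have "1 / real a ^ 2 * (2 / (real (M div a) + 1)) \<le> 1 / real a ^ 2 * (2 * real a / real M)"
        by (rule mult_left_mono) simp
      also have "\<dots> = 2 / real M * (1 / real a)" using a by (simp add: power2_eq_square)
      finally show "1 / real a ^ 2 * (2 / (real (M div a) + 1)) \<le> 2 / real M * (1 / real a)" .
    qed
    have "(\<Sum>a\<in>{M<..N}. 1 / real a ^ 2 * 2) \<le> 2 / (real M + 1) * 2"
      unfolding sum_distrib_right[symmetric] by (intro mult_right_mono sum_inverse_square_tail) simp
    also have "\<dots> \<le> 4 / real M" using assms by (simp add: field_simps)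
    finally show "(\<Sum>a\<in>{M<..N}. 1 / real a ^ 2 * 2) \<le> 4 / real M" .
  qed
  also have "\<dots> = (2 * (\<Sum>n = 1..M. 1 / real n) + 4) / real M"
    by (simp only: sum_distrib_left[symmetric] add_divide_distrib) simp
  finally show ?thesis .
qed

text \<open>A divisor \<open>d\<close> of \<open>n\<close> yields the pair
  \<open>(d, n div d)\<close>, which determines both; expanding the square gives all pairs up to
  \<open>N\<close>.\<close>

lemma sum_divisor_count_le:
  fixes h :: "nat \<Rightarrow> real"
  assumes h: "\<And>m n. h (m * n) = h m * h n" "\<And>n. h n \<ge> 0"
  shows "(\<Sum>n = 1..N. divisor_count n * h n) \<le> (\<Sum>n = 1..N. h n) ^ 2"
proof -
  have "(\<Sum>n = 1..N. divisor_count n * h n) = (\<Sum>(n, d)\<in>(SIGMA n:{1..N}. {d. d dvd n}). h n)"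
    by (rule sum_divisor_count_eq) auto
  also have "\<dots> \<le> (\<Sum>(a, b)\<in>{1..N} \<times> {1..N}. h a * h b)"
  proof (rule sum_le_included[where i = "\<lambda>(a, b). (a * b, a)"])
    show "\<forall>s\<in>(SIGMA n:{1..N}. {d. d dvd n}). \<exists>t\<in>{1..N} \<times> {1..N}.
        (case t of (a, b) \<Rightarrow> (a * b, a)) = s \<and> (case s of (n, d) \<Rightarrow> h n) \<le> (case t of (a, b) \<Rightarrow> h a * h b)"
    proof safe
      fix n d assume n: "n \<in> {1..N}" and "d dvd n"
      then obtain e where e: "n = d * e" by auto
      have "d > 0" "e > 0" using n e by (auto intro!: Nat.gr0I)
      then have "d \<le> n" "e \<le> n" using e by simp_all
      then have "(d, e) \<in> {1..N} \<times> {1..N}" using n \<open>d > 0\<close> \<open>e > 0\<close> by auto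
      then show "\<exists>t\<in>{1..N} \<times> {1..N}. (case t of (a, b) \<Rightarrow> (a * b, a)) = (n, d) \<and>
          h n \<le> (case t of (a, b) \<Rightarrow> h a * h b)"
        by (rule bexI[rotated]) (simp add: e h)
    qed
  qed (auto simp: h intro: finite_subset[of _ "SIGMA n:{1..N}. {..n}"] dest: dvd_imp_le)
  also have "\<dots> = (\<Sum>n = 1..N. h n) ^ 2"
    by (simp add: power2_eq_square sum_product sum.cartesian_product)
  finally show ?thesis .
qed

text \<open>A pair of divisors \<open>d\<close>, \<open>e\<close> of \<open>n\<close> is recovered from the four factors
  \<open>gcd d e\<close>, \<open>d div gcd d e\<close>, \<open>e div gcd d e\<close>, \<open>n div lcm d e\<close>, whose product is \<open>n\<close>.\<close>

lemma sum_divisor_count_square_le: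
  fixes h :: "nat \<Rightarrow> real"
  assumes h: "\<And>m n. h (m * n) = h m * h n" "\<And>n. h n \<ge> 0"
  shows "(\<Sum>n = 1..N. divisor_count n ^ 2 * h n) \<le> (\<Sum>n = 1..N. h n) ^ 4"
proof -
  let ?D = "SIGMA n:{1..N}. {d. d dvd n} \<times> {d. d dvd n}"
  let ?I = "{1..N}"
  have eq: "(\<Sum>n = 1..N. divisor_count n ^ 2 * h n) = (\<Sum>(n, d, e)\<in>?D. h n)"
    by (subst sum.Sigma[symmetric]) (auto simp: card_cartesian_product power2_eq_square split_def)
  have main: "\<forall>s\<in>?D. \<exists>t\<in>?I \<times> ?I \<times> ?I \<times> ?I.
      (case t of (a, b, c, f) \<Rightarrow> (a * b * c * f, a * b, a * c)) = s \<and>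
      (case s of (n, d, e) \<Rightarrow> h n) \<le> (case t of (a, b, c, f) \<Rightarrow> h a * (h b * (h c * h f)))"
  proof
    fix s assume s: "s \<in> ?D"
    obtain n d e where [simp]: "s = (n, d, e)" by (cases s)
    have n: "n \<in> {1..N}" and de: "d dvd n" "e dvd n" using s by auto
    define g where "g = gcd d e"
    have "n > 0" using n by simp
    then have "d > 0" "e > 0" using de by (auto intro!: Nat.gr0I)
    then have "g > 0" by (simp add: g_def)
    obtain b c where bc: "d = g * b" "e = g * c"
      unfolding g_def by (metis dvdE gcd_dvd1 gcd_dvd2)
    obtain f where f: "n = lcm d e * f" using de by (metis dvdE lcm_least)
    have "g * lcm d e = d * e" unfolding g_def by (metis prod_gcd_lcm_nat)
    then have "lcm d e = g * b * c" using bc \<open>g > 0\<close> by simp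
    then have nf: "n = g * b * c * f" using f by simp
    have "g dvd n" "b dvd n" "c dvd n" "f dvd n" by (simp_all add: nf)
    then have "(g, b, c, f) \<in> ?I \<times> ?I \<times> ?I \<times> ?I"
      using n \<open>n > 0\<close> by (auto intro!: Nat.gr0I[THEN Suc_leI] dest: dvd_imp_le)
    then show "\<exists>t\<in>?I \<times> ?I \<times> ?I \<times> ?I.
      (case t of (a, b, c, f) \<Rightarrow> (a * b * c * f, a * b, a * c)) = s \<and>
      (case s of (n, d, e) \<Rightarrow> h n) \<le> (case t of (a, b, c, f) \<Rightarrow> h a * (h b * (h c * h f)))"
      by (rule bexI[rotated]) (simp add: nf bc h)
  qed
  have "finite ?D" by (intro finite_SigmaI) auto
  have "(\<Sum>(n, d, e)\<in>?D. h n) \<le> (\<Sum>(a, b, c, f)\<in>?I \<times> ?I \<times> ?I \<times> ?I. h a * (h b * (h c * h f)))"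
    by (rule sum_le_included[OF \<open>finite ?D\<close> _ _ main]) (auto simp: h)
  also have "\<dots> = (\<Sum>n = 1..N. h n) * ((\<Sum>n = 1..N. h n) * ((\<Sum>n = 1..N. h n) * (\<Sum>n = 1..N. h n)))"
    by (simp add: sum_product sum.cartesian_product split_def)
  also have "\<dots> = (\<Sum>n = 1..N. h n) ^ 4" by (simp add: power4_eq_xxxx mult.assoc)
  finally show ?thesis unfolding eq .
qed

subsection \<open>Euler products\<close>

lemma
  fixes f :: "'a \<Rightarrow> real" and g :: "'b \<Rightarrow> real"
  assumes f: "(\<lambda>x. \<bar>f x\<bar>) summable_on A" and g: "(\<lambda>y. \<bar>g y\<bar>) summable_on B"
  shows abs_summable_on_Times_mult: "(\<lambda>(x, y). \<bar>f x * g y\<bar>) summable_on A \<times> B"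
    and has_sum_Times_mult: "((\<lambda>(x, y). f x * g y) has_sum (infsum f A * infsum g B)) (A \<times> B)"
proof -
  show 1: "(\<lambda>(x, y). \<bar>f x * g y\<bar>) summable_on A \<times> B"
  proof (rule summable_on_SigmaI)
    show "((\<lambda>y. case (x, y) of (x, y) \<Rightarrow> \<bar>f x * g y\<bar>) has_sum (\<bar>f x\<bar> * infsum (\<lambda>y. \<bar>g y\<bar>) B)) B" for x
      using g by (simp add: abs_mult has_sum_cmult_right)
    show "(\<lambda>x. \<bar>f x\<bar> * infsum (\<lambda>y. \<bar>g y\<bar>) B) summable_on A"
      using f by (rule summable_on_cmult_left)
  qed auto
  show "((\<lambda>(x, y). f x * g y) has_sum (infsum f A * infsum g B)) (A \<times> B)"
  proof (rule has_sum_SigmaI)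
    show "((\<lambda>y. case (x, y) of (x, y) \<Rightarrow> f x * g y) has_sum (f x * infsum g B)) B" for x
      using summable_on_abs_imp[OF g] by (simp add: has_sum_cmult_right)
    show "((\<lambda>x. f x * infsum g B) has_sum (infsum f A * infsum g B)) A"
      using summable_on_abs_imp[OF f] by (intro has_sum_cmult_left) simp
    show "(\<lambda>(x, y). f x * g y) summable_on A \<times> B"
      by (rule summable_on_abs_imp) (use 1 in \<open>simp add: split_def\<close>)
  qed
qed

text \<open>Positivity is required explicitly because \<open>0\<close> has an empty set of prime
  factors.\<close>

definition smooth :: "nat set \<Rightarrow> nat set" where
  "smooth P = {n. n > 0 \<and> prime_factors n \<subseteq> P}"

text \<open>Each number splits uniquely into its exact power of \<open>q\<close> and a part prime to
  \<open>q\<close>. This adds one prime to a finite Euler product.\<close>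

lemma bij_betw_smooth_insert:
  assumes q: "prime q" "q \<notin> P"
  shows "bij_betw (\<lambda>(n, a). n * q ^ a) (smooth P \<times> UNIV) (smooth (insert q P))"
proof (rule bij_betwI[where g = "\<lambda>m. (m div q ^ multiplicity q m, multiplicity q m)"])
  have q0: "q > 0" using q prime_gt_0_nat by auto
  show "(\<lambda>(n, a). n * q ^ a) \<in> smooth P \<times> UNIV \<rightarrow> smooth (insert q P)"
    using q q0 by (auto simp: smooth_def prime_factors_product prime_factorization_prime_power
      subset_iff split: if_splits)
  show "(\<lambda>m. (m div q ^ multiplicity q m, multiplicity q m)) \<in> smooth (insert q P) \<rightarrow> smooth P \<times> UNIV"
  proof
    fix m assume m: "m \<in> smooth (insert q P)"
    then have "m > 0" by (simp add: smooth_def)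
    moreover have "\<not> is_unit q" using q not_prime_unit by blast
    ultimately obtain n where n: "m = q ^ multiplicity q m * n" "\<not> q dvd n"
      using multiplicity_decompose'[of m q] by blast
    have "n > 0" using n(2) by (auto intro: Nat.gr0I)
    moreover have "m div q ^ multiplicity q m = n"
      using arg_cong[OF n(1), of "\<lambda>j. j div q ^ multiplicity q m"] q0 by simp
    moreover have "prime_factors n \<subseteq> P"
    proof
      fix p assume p: "p \<in> prime_factors n"
      then have "p dvd m" by (subst n(1)) auto
      then have "p \<in> insert q P" using p m \<open>m > 0\<close> by (auto simp: smooth_def prime_factors_dvd)
      then show "p \<in> P" using p n(2) by auto
    qed
    ultimately show "(m div q ^ multiplicity q m, multiplicity q m) \<in> smooth P \<times> UNIV"
      by (simp add: smooth_def)
  qed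
  show "(\<lambda>m. (m div q ^ multiplicity q m, multiplicity q m)) ((\<lambda>(n, a). n * q ^ a) x) = x"
    if x: "x \<in> smooth P \<times> UNIV" for x
  proof -
    obtain n a where [simp]: "x = (n, a)" by (cases x)
    have n: "n > 0" "\<not> q dvd n" using x q by (auto simp: smooth_def prime_factors_dvd)
    then have "multiplicity q (n * q ^ a) = a"
      using q q0 by (simp add: prime_elem_multiplicity_mult_distrib not_dvd_imp_multiplicity_0)
    then show ?thesis using q0 by simp
  qed
  show "(\<lambda>(n, a). n * q ^ a) (m div q ^ multiplicity q m, multiplicity q m) = m" for m
    by (simp add: multiplicity_dvd)
qed

text \<open>Induction on \<open>P\<close>, splitting off the power of the new prime. Absolute
  summability is carried along because each step multiplies two infinite sums.\<close>

lemma euler_product_smooth: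
  assumes f: "multiplicative_function f" and "finite P" "\<And>p. p \<in> P \<Longrightarrow> prime p"
    and "\<And>p. p \<in> P \<Longrightarrow> (\<lambda>a. \<bar>f (p ^ a)\<bar>) summable_on UNIV"
  shows "(\<lambda>n. \<bar>f n\<bar>) summable_on smooth P \<and> (f has_sum (\<Prod>p\<in>P. \<Sum>\<^sub>\<infinity>a. f (p ^ a))) (smooth P)"
  using assms(2-)
proof (induction P)
  case empty
  have "smooth {} = {1}" by (auto simp: smooth_def prime_factorization_empty_iff)
  then show ?case using f by (auto simp: multiplicative_function_def intro: has_sum_finiteI)
next
  case (insert q P)
  have IH: "(\<lambda>n. \<bar>f n\<bar>) summable_on smooth P" "(f has_sum (\<Prod>p\<in>P. \<Sum>\<^sub>\<infinity>a. f (p ^ a))) (smooth P)"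
    using insert by auto
  have q: "prime q" "(\<lambda>a. \<bar>f (q ^ a)\<bar>) summable_on UNIV" using insert.prems by auto
  note bij = bij_betw_smooth_insert[OF q(1) insert.hyps(2)]
  have eq: "f (n * q ^ a) = f n * f (q ^ a)" if "n \<in> smooth P" for n a
  proof -
    have "n > 0" "\<not> q dvd n" using that insert.hyps q by (auto simp: smooth_def prime_factors_dvd)
    moreover from this have "coprime q n" using q by (intro prime_imp_coprime)
    then have "coprime n (q ^ a)" by (simp add: coprime_commute)
    ultimately show ?thesis using f prime_gt_0_nat[OF q(1)] by (simp add: multiplicative_function_def)
  qed
  have "(\<lambda>x. \<bar>f ((\<lambda>(n, a). n * q ^ a) x)\<bar>) summable_on smooth P \<times> UNIV"
    using abs_summable_on_Times_mult[OF IH(1) q(2)]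
    by (rule summable_on_cong[THEN iffD1, rotated]) (auto simp: eq)
  then have 1: "(\<lambda>n. \<bar>f n\<bar>) summable_on smooth (insert q P)"
    by (subst (asm) summable_on_reindex_bij_betw[OF bij])
  have "((\<lambda>x. f ((\<lambda>(n, a). n * q ^ a) x)) has_sum (infsum f (smooth P) * (\<Sum>\<^sub>\<infinity>a. f (q ^ a)))) (smooth P \<times> UNIV)"
    using has_sum_Times_mult[OF IH(1) q(2)]
    by (rule has_sum_cong[THEN iffD1, rotated]) (auto simp: eq)
  then have "(f has_sum (infsum f (smooth P) * (\<Sum>\<^sub>\<infinity>a. f (q ^ a)))) (smooth (insert q P))"
    by (subst (asm) has_sum_reindex_bij_betw[OF bij])
  then show ?case using 1 insert.hyps infsumI[OF IH(2)] by (simp add: mult.commute)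
qed

lemma abs_summable_on_prime_powers:
  fixes f :: "nat \<Rightarrow> real"
  assumes f: "(\<lambda>n. \<bar>f n\<bar>) summable_on {0<..}" and p: "prime p"
  shows "(\<lambda>a. \<bar>f (p ^ a)\<bar>) summable_on UNIV"
proof -
  have "inj (\<lambda>a::nat. p ^ a)" using prime_gt_1_nat[OF p] by (auto intro: injI)
  moreover have "(\<lambda>n. \<bar>f n\<bar>) summable_on range (\<lambda>a. p ^ a)"
    using prime_gt_0_nat[OF p] by (intro summable_on_subset_banach[OF f]) auto
  ultimately show ?thesis by (simp add: summable_on_reindex o_def)
qed

lemma smooth_primes_le: "{1..N} \<subseteq> smooth {p. prime p \<and> p \<le> N}"
  by (auto simp: smooth_def prime_factors_dvd dest!: dvd_imp_le)

text \<open>All primes of an \<open>n \<le> N\<close> are at most \<open>N\<close>, so the partial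
  product misses only terms with index above \<open>N\<close>; the tail of the absolute series
  bounds the error.\<close>

lemma euler_product_tendsto:
  assumes f: "multiplicative_function f" and summ: "(\<lambda>n. \<bar>f n\<bar>) summable_on {0<..}"
  shows "(\<lambda>N. \<Prod>p | prime p \<and> p \<le> N. \<Sum>\<^sub>\<infinity>a. f (p ^ a)) \<longlonglongrightarrow> infsum f {0<..}"
proof -
  define P where "P N = {p. prime p \<and> p \<le> (N::nat)}" for N
  \<comment> \<open>Because of the shift by \<open>Suc\<close>, this is the absolute sum over the
    indices above \<open>N\<close>.\<close>
  define t where "t N = infsum (\<lambda>n. \<bar>f n\<bar>) {0<..} - (\<Sum>n<N. \<bar>f (Suc n)\<bar>)" for N
  have "(\<lambda>n. \<bar>f (Suc n)\<bar>) sums infsum (\<lambda>n. \<bar>f n\<bar>) {0<..}"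
    using suminf_Suc_eq_infsum[OF summ] by (simp add: sums_iff)
  then have "t \<longlonglongrightarrow> infsum (\<lambda>n. \<bar>f n\<bar>) {0<..} - infsum (\<lambda>n. \<bar>f n\<bar>) {0<..}"
    unfolding t_def sums_def by (intro tendsto_intros)
  then have t: "t \<longlonglongrightarrow> 0" by simp
  have "\<bar>(\<Prod>p\<in>P N. \<Sum>\<^sub>\<infinity>a. f (p ^ a)) - infsum f {0<..}\<bar> \<le> t N" for N
  proof -
    have fin: "finite (P N)" by (rule finite_subset[of _ "{..N}"]) (auto simp: P_def)
    have "(f has_sum (\<Prod>p\<in>P N. \<Sum>\<^sub>\<infinity>a. f (p ^ a))) (smooth (P N))"
      by (rule euler_product_smooth[OF f fin, THEN conjunct2])
        (auto simp: P_def intro: abs_summable_on_prime_powers[OF summ])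
    then have "(\<Prod>p\<in>P N. \<Sum>\<^sub>\<infinity>a. f (p ^ a)) = infsum f (smooth (P N))"
      by (simp add: infsumI)
    moreover have sub: "smooth (P N) \<subseteq> {0<..}" by (auto simp: smooth_def)
    moreover have "infsum f ({0<..} - smooth (P N)) = infsum f {0<..} - infsum f (smooth (P N))"
      using summable_on_abs_imp[OF summ] sub
      by (intro infsum_Diff summable_on_subset_banach[OF summable_on_abs_imp[OF summ]]) auto
    moreover have "\<bar>infsum f ({0<..} - smooth (P N))\<bar> \<le> infsum (\<lambda>n. \<bar>f n\<bar>) ({0<..} - smooth (P N))"
      using norm_infsum_bound[of f "{0<..} - smooth (P N)"] summable_on_subset_banach[OF summ] by simp
    moreover have "infsum (\<lambda>n. \<bar>f n\<bar>) ({0<..} - smooth (P N)) \<le> infsum (\<lambda>n. \<bar>f n\<bar>) ({0<..} - {1..N})"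
      using smooth_primes_le[of N] summable_on_subset_banach[OF summ]
      by (intro infsum_mono2) (auto simp: P_def)
    moreover have "infsum (\<lambda>n. \<bar>f n\<bar>) ({0<..} - {1..N}) = t N"
      using summ by (subst infsum_Diff) (auto simp: t_def sum.atLeast1_atMost_eq)
    ultimately show ?thesis by linarith
  qed
  then have "(\<lambda>N. (\<Prod>p\<in>P N. \<Sum>\<^sub>\<infinity>a. f (p ^ a)) - infsum f {0<..}) \<longlonglongrightarrow> 0"
    by (intro Lim_null_comparison[OF _ t]) auto
  then show ?thesis unfolding P_def by (simp add: LIM_zero_iff)
qed

lemma infsum_prime_powers:
  assumes f: "multiplicative_function f" and summ: "(\<lambda>a. f (p ^ a)) summable_on UNIV"
  shows "(\<Sum>\<^sub>\<infinity>a. f (p ^ a)) = 1 + (\<Sum>\<^sub>\<infinity>a\<in>{0<..}. f (p ^ a))"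
proof -
  have "UNIV = insert (0::nat) {0<..}" by auto
  then have "(\<Sum>\<^sub>\<infinity>a. f (p ^ a)) = infsum (\<lambda>a. f (p ^ a)) (insert 0 {0<..})" by simp
  also have "\<dots> = f (p ^ 0) + (\<Sum>\<^sub>\<infinity>a\<in>{0<..}. f (p ^ a))"
    using summable_on_subset_banach[OF summ] by (intro infsum_insert) auto
  finally show ?thesis using f by (simp add: multiplicative_function_def)
qed

text \<open>The limit of the partial products is not enough for \<open>has_prod\<close>, since they
  might tend to zero without a vanishing factor. Absolute convergence comes from bounding
  \<open>u p - 1\<close> by the absolute sum over the powers of \<open>p\<close>; the limit then
  identifies the value.\<close>

lemma has_prod_euler_product:
  assumes f: "multiplicative_function f" and summ: "(\<lambda>n. \<bar>f n\<bar>) summable_on {0<..}"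
  shows "(\<lambda>p. if prime p then \<Sum>\<^sub>\<infinity>a. f (p ^ a) else 1) has_prod infsum f {0<..}"
proof -
  define u where "u p = (if prime p then \<Sum>\<^sub>\<infinity>a. f (p ^ a) else 1)" for p :: nat
  have pow: "(\<lambda>a. \<bar>f (p ^ a)\<bar>) summable_on UNIV" if "prime p" for p
    by (rule abs_summable_on_prime_powers[OF summ that])
  \<comment> \<open>Prime powers with positive exponent determine base and exponent, so the double
    sum is part of the absolute series.\<close>
  have "inj_on (\<lambda>(p, a). p ^ a) ({p::nat. prime p} \<times> {0::nat<..})"
    by (auto simp: inj_on_def prime_power_inj'')
  moreover have "(\<lambda>n. \<bar>f n\<bar>) summable_on (\<lambda>(p, a). p ^ a) ` ({p. prime p} \<times> {0<..})"
    by (intro summable_on_subset_banach[OF summ]) (auto simp: prime_gt_0_nat)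
  ultimately have "(\<lambda>(p, a). \<bar>f (p ^ a)\<bar>) summable_on {p. prime p} \<times> {0<..}"
    by (simp add: summable_on_reindex o_def split_def)
  then have "(\<lambda>p. \<Sum>\<^sub>\<infinity>a\<in>{0<..}. \<bar>f (p ^ a)\<bar>) summable_on {p. prime p}"
    by (rule summable_on_Sigma_banach)
  then have "(\<lambda>p. \<bar>u p - 1\<bar>) summable_on {p. prime p}"
  proof (rule summable_on_comparison_test)
    fix p :: nat assume "p \<in> {p. prime p}"
    then have p: "prime p" by simp
    have sub: "(\<lambda>a. \<bar>f (p ^ a)\<bar>) summable_on {0<..}"
      using summable_on_subset_banach[OF pow[OF p]] by auto
    have "u p - 1 = (\<Sum>\<^sub>\<infinity>a\<in>{0<..}. f (p ^ a))"
      using infsum_prime_powers[OF f summable_on_abs_imp[OF pow[OF p]]] p by (simp add: u_def)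
    then show "\<bar>u p - 1\<bar> \<le> (\<Sum>\<^sub>\<infinity>a\<in>{0<..}. \<bar>f (p ^ a)\<bar>)"
      using norm_infsum_bound[of "\<lambda>a. f (p ^ a)" "{0<..}"] sub by simp
  qed auto
  then have "(\<lambda>p. \<bar>u p - 1\<bar>) summable_on UNIV"
    by (rule summable_on_cong_neutral[THEN iffD1, rotated -1]) (auto simp: u_def)
  then have "summable (\<lambda>p. norm (u p - 1))"
    using has_sum_imp_sums[OF has_sum_infsum] by (auto simp: sums_iff)
  then have conv: "convergent_prod u"
    by (intro abs_convergent_prod_imp_convergent_prod summable_imp_abs_convergent_prod)
  have "(\<Prod>p\<le>N. u p) = (\<Prod>p | prime p \<and> p \<le> N. \<Sum>\<^sub>\<infinity>a. f (p ^ a))" for N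
  proof -
    have "{p. prime p \<and> p \<le> N} = {p \<in> {..N}. prime p}" by auto
    then show ?thesis unfolding u_def by (simp only: prod.inter_filter[OF finite_atMost])
  qed
  then have "prodinf u = infsum f {0<..}"
    using LIMSEQ_unique[OF convergent_prod_LIMSEQ[OF conv]] euler_product_tendsto[OF f summ] by simp
  then show ?thesis using convergent_prod_has_prod[OF conv] by (simp add: u_def[abs_def])
qed

text \<open>The partial sum is at most the finite Euler product over the primes up to
  \<open>N\<close>. Each factor is at most \<open>1 + c p \<le> exp (c p)\<close>, and the sum of
  the exponents is bounded independently of \<open>N\<close>.\<close>

lemma sum_multiplicative_le_exp:
  fixes c :: "nat \<Rightarrow> real"
  assumes f: "multiplicative_function f" "\<And>n. f n \<ge> 0"
    and pow: "\<And>p. prime p \<Longrightarrow> (\<lambda>a. f (p ^ a)) summable_on UNIV"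
    and c: "\<And>p. prime p \<Longrightarrow> (\<Sum>\<^sub>\<infinity>a. f (p ^ a)) \<le> 1 + c p" "\<And>p. prime p \<Longrightarrow> c p \<ge> 0"
      "c summable_on {p. prime p}"
  shows "(\<Sum>n = 1..N. f n) \<le> exp (infsum c {p. prime p})"
proof -
  define P where "P = {p. prime p \<and> p \<le> N}"
  have P: "finite P" "P \<subseteq> {p. prime p}" by (auto simp: P_def)
  have "(f has_sum (\<Prod>p\<in>P. \<Sum>\<^sub>\<infinity>a. f (p ^ a))) (smooth P)"
    using euler_product_smooth[OF f(1), of P] P f pow by auto
  then have summ: "f summable_on smooth P" and eq: "infsum f (smooth P) = (\<Prod>p\<in>P. \<Sum>\<^sub>\<infinity>a. f (p ^ a))"
    by (auto simp: infsumI summable_on_def)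
  have "(\<Sum>n = 1..N. f n) \<le> infsum f (smooth P)"
    using summ smooth_primes_le f by (intro finite_sum_le_infsum) (auto simp: P_def)
  also have "\<dots> \<le> (\<Prod>p\<in>P. exp (c p))"
    unfolding eq
  proof (intro prod_mono conjI)
    fix p assume "p \<in> P"
    then have "prime p" using P by auto
    then show "(\<Sum>\<^sub>\<infinity>a. f (p ^ a)) \<le> exp (c p)" using c(1)[of p] exp_ge_add_one_self[of "c p"] by linarith
    show "0 \<le> (\<Sum>\<^sub>\<infinity>a. f (p ^ a))" by (intro infsum_nonneg f)
  qed
  also have "\<dots> = exp (\<Sum>p\<in>P. c p)" using P by (simp add: exp_sum)
  also have "\<dots> \<le> exp (infsum c {p. prime p})"
    using P c by (auto intro!: finite_sum_le_infsum)
  finally show ?thesis .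
qed

subsection \<open>Remainder and density\<close>

lemma two_power_omega_le_divisor_count:
  assumes "n > 0"
  shows "2 ^ card (prime_factors n) \<le> divisor_count n"
proof -
  have "card {d. d udvd n} \<le> card {d. d dvd n}"
    using assms by (intro card_mono) (auto simp: unitary_dvd_def)
  then have "real (2 ^ card (prime_factors n)) \<le> divisor_count n"
    unfolding card_udvd[OF assms] by (rule of_nat_mono)
  then show ?thesis by simp
qed

lemma abs_mu_star_le_divisor_count:
  "n > 0 \<Longrightarrow> \<bar>mu_star S n\<bar> \<le> divisor_count n"
  using abs_mu_star_le_omega two_power_omega_le_divisor_count order_trans by blast

lemma divisor_count_le_square: "divisor_count n \<le> divisor_count n ^ 2"
  by (cases "card {d. d dvd n} = 0") (auto intro!: self_le_power)

lemma abs_mu_star_le_divisor_count_square: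
  "n > 0 \<Longrightarrow> \<bar>mu_star S n\<bar> \<le> divisor_count n ^ 2"
  using abs_mu_star_le_divisor_count divisor_count_le_square order_trans by blast

lemma abs_mu_star_omega_le:
  assumes "n > 0"
  shows "\<bar>mu_star S n\<bar> * 2 ^ card (prime_factors n) \<le> divisor_count n ^ 2"
  unfolding power2_eq_square
  using assms by (intro mult_mono abs_mu_star_le_divisor_count two_power_omega_le_divisor_count) auto

text \<open>The constant is \<open>2 ^ 4\<close>: the inverse squares sum to at most
  \<open>2\<close> and enter to the fourth power.\<close>

lemma sum_divisor_count_square_bounded:
  "(\<Sum>n\<in>{M<..N}. divisor_count n ^ 2 / real n ^ 2) \<le> 16"
proof -
  have "(\<Sum>n\<in>{M<..N}. divisor_count n ^ 2 / real n ^ 2) \<le> (\<Sum>n = 1..N. divisor_count n ^ 2 * (1 / real n ^ 2))"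
    by (simp, rule sum_mono2) auto
  also have "\<dots> \<le> (\<Sum>n = 1..N. 1 / real n ^ 2) ^ 4"
    by (rule sum_divisor_count_square_le) (auto simp: power_mult_distrib)
  also have "\<dots> \<le> 2 ^ 4"
    using sum_inverse_square_tail[of 0 N] atLeastSucAtMost_greaterThanAtMost[of 0 N]
    by (intro power_mono sum_nonneg) auto
  finally show ?thesis by simp
qed

lemma abs_mu_star_summable:
  assumes "k \<ge> 2"
  shows "(\<lambda>n. \<bar>mu_star S n\<bar> / real n ^ k) summable_on {0<..}"
proof (rule summable_on_greaterThan_bound(1))
  fix N
  have "\<bar>mu_star S n\<bar> / real n ^ k \<le> divisor_count n ^ 2 / real n ^ 2" if "n > 0" for n
    using that assms abs_mu_star_le_divisor_count_square[OF that, of S]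
    by (intro frac_le power_increasing) auto
  then have "(\<Sum>n\<in>{0<..N}. \<bar>mu_star S n\<bar> / real n ^ k) \<le> (\<Sum>n\<in>{0<..N}. divisor_count n ^ 2 / real n ^ 2)"
    by (intro sum_mono) auto
  then show "(\<Sum>n\<in>{0<..N}. \<bar>mu_star S n\<bar> / real n ^ k) \<le> 16"
    using sum_divisor_count_square_bounded order_trans by blast
qed auto

lemma nat_floor_bounds:
  assumes "x \<ge> 1"
  shows "nat \<lfloor>x\<rfloor> \<ge> 1" "real (nat \<lfloor>x\<rfloor>) \<le> x" "x < real (nat \<lfloor>x\<rfloor>) + 1" "x \<le> 2 * real (nat \<lfloor>x\<rfloor>)"
proof -
  show 1: "nat \<lfloor>x\<rfloor> \<ge> 1" and "real (nat \<lfloor>x\<rfloor>) \<le> x" and 2: "x < real (nat \<lfloor>x\<rfloor>) + 1"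
    using assms by (auto simp: le_nat_floor_iff)
  have "real (nat \<lfloor>x\<rfloor>) \<ge> 1" using 1 by linarith
  then show "x \<le> 2 * real (nat \<lfloor>x\<rfloor>)" using 2 by linarith
qed

lemma sum_inverse_floor_le:
  assumes "x \<ge> 1"
  shows "(\<Sum>n = 1..nat \<lfloor>x\<rfloor>. 1 / real n) \<le> 1 + ln x"
proof -
  have "(\<Sum>n = 1..nat \<lfloor>x\<rfloor>. 1 / real n) \<le> 1 + ln (real (nat \<lfloor>x\<rfloor>))"
    using nat_floor_bounds[OF assms] by (intro sum_inverse_le_ln)
  also have "ln (real (nat \<lfloor>x\<rfloor>)) \<le> ln x"
    using nat_floor_bounds[OF assms] assms by (subst ln_le_cancel_iff) auto
  finally show ?thesis by simp
qed

text \<open>Bounds uniform in \<open>M\<close> on finite sections control the infinite tail, so each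
  case only has to treat finite sums.\<close>

lemma V_bound_tail:
  assumes k: "k \<ge> 2" and x: "x \<ge> 1"
    and main: "(\<Sum>d = 1..nat \<lfloor>x\<rfloor>. \<bar>mu_star S d\<bar> * 2 ^ card (prime_factors d) / real d ^ (k - 1)) \<le> A"
    and tail: "\<And>M. (\<Sum>d\<in>{nat \<lfloor>x\<rfloor><..M}. \<bar>mu_star S d\<bar> / real d ^ k) \<le> T"
  shows "\<bar>V k x S\<bar> \<le> real k * x ^ (k - 1) * A + x ^ k * T"
proof -
  have "\<bar>V k x S\<bar> \<le>
    real k * x ^ (k - 1) * (\<Sum>d = 1..nat \<lfloor>x\<rfloor>. \<bar>mu_star S d\<bar> * 2 ^ card (prime_factors d) / real d ^ (k - 1))
    + x ^ k * infsum (\<lambda>d. \<bar>mu_star S d\<bar> / real d ^ k) {nat \<lfloor>x\<rfloor><..}"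
    using k x by (intro V_bound abs_mu_star_summable) auto
  also have "\<dots> \<le> real k * x ^ (k - 1) * A + x ^ k * T"
    using x main tail by (intro add_mono mult_left_mono summable_on_greaterThan_bound(2)) auto
  finally show ?thesis .
qed

text \<open>Here \<open>k - 1 \<ge> 2\<close>, so the main sum is bounded by the convergent sum of
  squared divisor counts over squares. In the tail, \<open>d \<ge> x\<close> turns one spare factor
  \<open>d\<close> into \<open>x\<close>.\<close>

lemma V_bound_gt_2:
  assumes k: "k > 2" and x: "x \<ge> 1"
  shows "\<bar>V k x S\<bar> \<le> 16 * (real k + 1) * x ^ (k - 1)"
proof -
  have "\<bar>V k x S\<bar> \<le> real k * x ^ (k - 1) * 16 + x ^ k * (16 / x)"
  proof (rule V_bound_tail)
    have "(\<Sum>d = 1..nat \<lfloor>x\<rfloor>. \<bar>mu_star S d\<bar> * 2 ^ card (prime_factors d) / real d ^ (k - 1))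
      \<le> (\<Sum>d\<in>{0<..nat \<lfloor>x\<rfloor>}. divisor_count d ^ 2 / real d ^ 2)"
      unfolding atLeastSucAtMost_greaterThanAtMost[symmetric] One_nat_def
      using k by (intro sum_mono frac_le abs_mu_star_omega_le power_increasing) auto
    then show "(\<Sum>d = 1..nat \<lfloor>x\<rfloor>. \<bar>mu_star S d\<bar> * 2 ^ card (prime_factors d) / real d ^ (k - 1)) \<le> 16"
      using sum_divisor_count_square_bounded order_trans by blast
  next
    fix M
    have "\<bar>mu_star S d\<bar> / real d ^ k \<le> divisor_count d ^ 2 / real d ^ 2 * (1 / x)"
      if "d > nat \<lfloor>x\<rfloor>" for d
    proof -
      have d: "d > 0" "real d \<ge> x" using that nat_floor_bounds[OF x] by linarith+
      have "real d ^ 2 * x \<le> real d ^ 2 * real d" using d by (intro mult_left_mono) auto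
      also have "\<dots> = real d ^ 3" by (simp add: power3_eq_cube power2_eq_square)
      also have "\<dots> \<le> real d ^ k" using d k by (intro power_increasing) auto
      finally have "\<bar>mu_star S d\<bar> / real d ^ k \<le> divisor_count d ^ 2 / (real d ^ 2 * x)"
        using d x abs_mu_star_le_divisor_count_square[of d S]
        by (intro frac_le) auto
      then show ?thesis by simp
    qed
    then have "(\<Sum>d\<in>{nat \<lfloor>x\<rfloor><..M}. \<bar>mu_star S d\<bar> / real d ^ k)
        \<le> (\<Sum>d\<in>{nat \<lfloor>x\<rfloor><..M}. divisor_count d ^ 2 / real d ^ 2 * (1 / x))"
      by (intro sum_mono) auto
    also have "\<dots> \<le> 16 * (1 / x)"
      unfolding sum_distrib_right[symmetric] using x
      by (intro mult_right_mono sum_divisor_count_square_bounded) auto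
    finally show "(\<Sum>d\<in>{nat \<lfloor>x\<rfloor><..M}. \<bar>mu_star S d\<bar> / real d ^ k) \<le> 16 / x" by simp
  qed (use k x in auto)
  also have "x ^ k * (16 / x) = 16 * x ^ (k - 1)"
    using x k by (cases k) auto
  finally show ?thesis by (simp add: algebra_simps)
qed

lemma mu_star_square_tail:
  assumes x: "x \<ge> 1"
  shows "(\<Sum>d\<in>{nat \<lfloor>x\<rfloor><..M}. \<bar>mu_star S d\<bar> / real d ^ 2) \<le> (4 * ln x + 12) / x"
proof -
  define N where "N = nat \<lfloor>x\<rfloor>"
  note N = nat_floor_bounds[OF x, folded N_def]
  have "(\<Sum>d\<in>{N<..M}. \<bar>mu_star S d\<bar> / real d ^ 2) \<le> (\<Sum>d\<in>{N<..M}. divisor_count d / real d ^ 2)"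
    by (intro sum_mono divide_right_mono abs_mu_star_le_divisor_count) auto
  also have "\<dots> \<le> (2 * (\<Sum>n = 1..N. 1 / real n) + 4) / real N"
    using N by (intro sum_divisor_count_tail)
  \<comment> \<open>The harmonic sum is at most \<open>1 + ln x\<close>, and the floor
    \<open>N\<close> is at least \<open>x / 2\<close>.\<close>
  also have "\<dots> \<le> (2 * (1 + ln x) + 4) / (x / 2)"
    using N x sum_inverse_floor_le[OF x] by (intro frac_le) (auto simp: N_def)
  also have "\<dots> = (4 * ln x + 12) / x" by (simp add: field_simps)
  finally show ?thesis by (simp add: N_def)
qed

text \<open>The tail costs only \<open>x * ln x\<close> up to a constant, so for the bounds
  \<open>A\<close> with at least \<open>ln x ^ 2\<close> the main sum decides the order.\<close>

lemma V2_bound: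
  assumes x: "x \<ge> 1"
    and main: "(\<Sum>d = 1..nat \<lfloor>x\<rfloor>. \<bar>mu_star S d\<bar> * 2 ^ card (prime_factors d) / real d) \<le> A"
  shows "\<bar>V 2 x S\<bar> \<le> 2 * x * A + x * (4 * ln x + 12)"
proof -
  have "\<bar>V 2 x S\<bar> \<le> real 2 * x ^ (2 - 1) * A + x ^ 2 * ((4 * ln x + 12) / x)"
    using assms by (intro V_bound_tail mu_star_square_tail) auto
  also have "x ^ 2 * ((4 * ln x + 12) / x) = x * (4 * ln x + 12)"
    using x by (simp add: power2_eq_square)
  finally show ?thesis by simp
qed

text \<open>The bound \<open>1\<close> for \<open>mu_star\<close> removes the logarithm from the
  tail, as a remainder of order \<open>x\<close> requires.\<close>

lemma V2_bound_multiplicative: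
  assumes S: "multiplicative_set S" and x: "x \<ge> 1"
    and main: "(\<Sum>d = 1..nat \<lfloor>x\<rfloor>. \<bar>mu_star S d\<bar> * 2 ^ card (prime_factors d) / real d) \<le> A"
  shows "\<bar>V 2 x S\<bar> \<le> 2 * x * A + 2 * x"
proof -
  have tail: "(\<Sum>d\<in>{nat \<lfloor>x\<rfloor><..M}. \<bar>mu_star S d\<bar> / real d ^ 2) \<le> 2 / x" for M
  proof -
    have "(\<Sum>d\<in>{nat \<lfloor>x\<rfloor><..M}. \<bar>mu_star S d\<bar> / real d ^ 2) \<le> (\<Sum>d\<in>{nat \<lfloor>x\<rfloor><..M}. 1 / real d ^ 2)"
      using S by (intro sum_mono divide_right_mono abs_mu_star_multiplicative_le_1) auto
    also have "\<dots> \<le> 2 / (real (nat \<lfloor>x\<rfloor>) + 1)" by (rule sum_inverse_square_tail)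
    also have "\<dots> \<le> 2 / x" using nat_floor_bounds[OF x] x by (intro divide_left_mono) auto
    finally show ?thesis .
  qed
  have "\<bar>V 2 x S\<bar> \<le> real 2 * x ^ (2 - 1) * A + x ^ 2 * (2 / x)"
    using assms tail by (intro V_bound_tail) auto
  also have "x ^ 2 * (2 / x) = 2 * x" using x by (simp add: power2_eq_square)
  finally show ?thesis by simp
qed

section \<open>Weighted sums of \<open>mu_star\<close> up to \<open>x\<close>\<close>

lemma sum_mu_star_omega_le_ln4:
  assumes "x \<ge> 1"
  shows "(\<Sum>d = 1..nat \<lfloor>x\<rfloor>. \<bar>mu_star S d\<bar> * 2 ^ card (prime_factors d) / real d) \<le> (1 + ln x) ^ 4"
proof -
  have "(\<Sum>d = 1..nat \<lfloor>x\<rfloor>. \<bar>mu_star S d\<bar> * 2 ^ card (prime_factors d) / real d)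
      \<le> (\<Sum>d = 1..nat \<lfloor>x\<rfloor>. divisor_count d ^ 2 / real d)"
    by (intro sum_mono divide_right_mono abs_mu_star_omega_le) auto
  also have "\<dots> = (\<Sum>d = 1..nat \<lfloor>x\<rfloor>. divisor_count d ^ 2 * (1 / real d))"
    by simp
  also have "\<dots> \<le> (\<Sum>d = 1..nat \<lfloor>x\<rfloor>. 1 / real d) ^ 4"
    by (rule sum_divisor_count_square_le) auto
  also have "\<dots> \<le> (1 + ln x) ^ 4"
    using sum_inverse_floor_le[OF assms] by (intro power_mono sum_nonneg) auto
  finally show ?thesis .
qed

lemma sum_two_power_omega_le_ln2:
  assumes "x \<ge> 1"
  shows "(\<Sum>d = 1..nat \<lfloor>x\<rfloor>. 2 ^ card (prime_factors d) / real d) \<le> (1 + ln x) ^ 2"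
proof -
  have "(\<Sum>d = 1..nat \<lfloor>x\<rfloor>. 2 ^ card (prime_factors d) / real d)
      \<le> (\<Sum>d = 1..nat \<lfloor>x\<rfloor>. divisor_count d / real d)"
    by (intro sum_mono divide_right_mono two_power_omega_le_divisor_count) auto
  also have "\<dots> = (\<Sum>d = 1..nat \<lfloor>x\<rfloor>. divisor_count d * (1 / real d))"
    by simp
  also have "\<dots> \<le> (\<Sum>d = 1..nat \<lfloor>x\<rfloor>. 1 / real d) ^ 2"
    by (rule sum_divisor_count_le) auto
  also have "\<dots> \<le> (1 + ln x) ^ 2"
    using sum_inverse_floor_le[OF assms] by (intro power_mono sum_nonneg) auto
  finally show ?thesis .
qed

lemma sum_mu_star_omega_multiplicative:
  assumes "multiplicative_set S" "x \<ge> 1"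
  shows "(\<Sum>d = 1..nat \<lfloor>x\<rfloor>. \<bar>mu_star S d\<bar> * 2 ^ card (prime_factors d) / real d) \<le> (1 + ln x) ^ 2"
proof -
  have "(\<Sum>d = 1..nat \<lfloor>x\<rfloor>. \<bar>mu_star S d\<bar> * 2 ^ card (prime_factors d) / real d)
      \<le> (\<Sum>d = 1..nat \<lfloor>x\<rfloor>. 1 * 2 ^ card (prime_factors d) / real d)"
    using assms by (intro sum_mono divide_right_mono mult_right_mono abs_mu_star_multiplicative_le_1) auto
  also have "\<dots> \<le> (1 + ln x) ^ 2"
    using sum_two_power_omega_le_ln2[OF assms(2)] by simp
  finally show ?thesis .
qed

text \<open>Write \<open>n = d * e\<close> with \<open>d\<close> in \<open>S\<close> and
  \<open>e\<close> coprime to \<open>d\<close>. The weight \<open>w\<close> is multiplicative, so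
  the sum is at most a sum over \<open>S\<close>, controlled by the hypothesis, times the full sum
  of \<open>w\<close>, of order \<open>ln x ^ 2\<close>.\<close>

lemma sum_mu_star_omega_theta:
  assumes S: "S \<subseteq> {1..}" and summ: "(\<lambda>n. real (theta n) / real n) summable_on S" and x: "x \<ge> 1"
  shows "(\<Sum>d = 1..nat \<lfloor>x\<rfloor>. \<bar>mu_star S d\<bar> * 2 ^ card (prime_factors d) / real d)
    \<le> infsum (\<lambda>n. real (theta n) / real n) S * (1 + ln x) ^ 2"
proof -
  define N where "N = nat \<lfloor>x\<rfloor>"
  define w where "w n = 2 ^ card (prime_factors n) / real n" for n
  have w: "w (m * n) = w m * w n" if "m > 0" "n > 0" "coprime m n" for m n
    using multiplicative_function_divide[OF multiplicative_function_two_power_omega multiplicative_function_of_nat] that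
    by (simp add: multiplicative_function_def w_def)
  have w0: "w n \<ge> 0" for n by (simp add: w_def)
  have "(\<Sum>n = 1..N. \<bar>mu_star S n\<bar> * 2 ^ card (prime_factors n) / real n) = (\<Sum>n = 1..N. \<bar>mu_star S n\<bar> * w n)"
    by (simp add: w_def)
  also have "\<dots> \<le> (\<Sum>n = 1..N. real (card {d\<in>S. d udvd n}) * w n)"
    by (intro sum_mono mult_right_mono abs_mu_star_le) (auto simp: w_def)
  also have "\<dots> = (\<Sum>(n, d)\<in>(SIGMA n:{1..N}. {d\<in>S. d udvd n}). w n)"
    by (subst sum.Sigma[symmetric]) (auto intro: finite_subset[OF _ finite_udvd])
  also have "\<dots> \<le> (\<Sum>(d, e)\<in>(S \<inter> {1..N}) \<times> {1..N}. w d * w e)"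
  proof (rule sum_le_included[where i = "\<lambda>(d, e). (d * e, d)"])
    show "\<forall>s\<in>(SIGMA n:{1..N}. {d\<in>S. d udvd n}). \<exists>t\<in>(S \<inter> {1..N}) \<times> {1..N}.
        (case t of (d, e) \<Rightarrow> (d * e, d)) = s \<and> (case s of (n, d) \<Rightarrow> w n) \<le> (case t of (d, e) \<Rightarrow> w d * w e)"
    proof safe
      fix n d assume n: "n \<in> {1..N}" and d: "d \<in> S" "d udvd n"
      then obtain e where e: "n = d * e" by (auto simp: unitary_dvd_def)
      have pos: "d > 0" "e > 0" using n e by (auto intro!: Nat.gr0I)
      then have "coprime d e" using d e by (simp add: unitary_dvd_def)
      have "d \<le> n" "e \<le> n" using e pos by simp_all
      then have "(d, e) \<in> (S \<inter> {1..N}) \<times> {1..N}" using n pos d by auto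
      then show "\<exists>t\<in>(S \<inter> {1..N}) \<times> {1..N}. (case t of (d, e) \<Rightarrow> (d * e, d)) = (n, d) \<and>
          w n \<le> (case t of (d, e) \<Rightarrow> w d * w e)"
        by (rule bexI[rotated]) (simp add: e w pos \<open>coprime d e\<close>)
    qed
    show "finite (SIGMA n:{1..N}. {d\<in>S. d udvd n})"
      by (intro finite_SigmaI) (auto intro: finite_subset[OF _ finite_udvd])
  qed (auto simp: w0)
  also have "\<dots> = (\<Sum>d\<in>S \<inter> {1..N}. w d) * (\<Sum>e = 1..N. w e)"
    by (simp add: sum_product sum.cartesian_product)
  also have "\<dots> \<le> infsum (\<lambda>n. real (theta n) / real n) S * (1 + ln x) ^ 2"
  proof (rule mult_mono)
    have "(\<Sum>d\<in>S \<inter> {1..N}. w d) \<le> (\<Sum>d\<in>S \<inter> {1..N}. real (theta d) / real d)"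
    proof (rule sum_mono)
      fix d assume "d \<in> S \<inter> {1..N}"
      then have "real (2 ^ card (prime_factors d)) \<le> real (theta d)"
        using two_power_omega_le_theta[of d] by (intro of_nat_mono) auto
      then show "w d \<le> real (theta d) / real d"
        unfolding w_def by (intro divide_right_mono) auto
    qed
    also have "\<dots> \<le> infsum (\<lambda>n. real (theta n) / real n) S"
      by (rule finite_sum_le_infsum[OF summ]) auto
    finally show "(\<Sum>d\<in>S \<inter> {1..N}. w d) \<le> infsum (\<lambda>n. real (theta n) / real n) S" .
    show "(\<Sum>e = 1..N. w e) \<le> (1 + ln x) ^ 2"
      using sum_two_power_omega_le_ln2[OF x] by (simp add: w_def N_def)
  qed (auto intro: sum_nonneg infsum_nonneg w0)
  finally show ?thesis by (simp add: N_def)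
qed

lemma inverse_square_prime_summable: "(\<lambda>p. 1 / real p ^ 2) summable_on {p. prime p}"
proof -
  have "(\<lambda>n. 1 / real n ^ 2) summable_on {0<..}"
    using sum_inverse_square_tail[of 0] by (intro summable_on_greaterThan_bound(1)[where C = 2]) auto
  then show ?thesis by (rule summable_on_subset_banach) (auto simp: prime_gt_0_nat)
qed

text \<open>The summand is multiplicative, and for primes in \<open>S\<close> its value at
  \<open>p\<close> vanishes. The local factor is thus \<open>1\<close> up to
  \<open>4 / p\<^sup>2\<close>, plus \<open>2 / p\<close> for \<open>p\<close> outside
  \<open>S\<close> only, and these corrections are summable over the primes.\<close>

lemma sum_mu_star_omega_primes:
  assumes S: "multiplicative_set S"
    and summ: "(\<lambda>p. 1 / real p) summable_on {p. prime p \<and> p \<notin> S}"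
  obtains C where "\<And>N. (\<Sum>d = 1..N. \<bar>mu_star S d\<bar> * 2 ^ card (prime_factors d) / real d) \<le> C"
proof -
  define f where "f n = \<bar>mu_star S n\<bar> * 2 ^ card (prime_factors n) / real n" for n
  define c where "c p = (if p \<in> S then 0 else 2 / real p) + 4 / real p ^ 2" for p
  have f: "multiplicative_function f" unfolding f_def
    by (intro multiplicative_function_divide multiplicative_function_mult multiplicative_function_abs
        multiplicative_function_mu_star[OF S] multiplicative_function_two_power_omega multiplicative_function_of_nat)
  have f0: "f n \<ge> 0" for n by (simp add: f_def)
  have pow: "(\<lambda>a. f (p ^ a)) summable_on UNIV \<and> (\<Sum>\<^sub>\<infinity>a. f (p ^ a)) \<le> 1 + c p" if p: "prime p" for p
  proof -
    have p2: "real p \<ge> 2" using prime_ge_2_nat[OF p] by simp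
    define t where "t = (if p \<in> S then 2 / real p else 0)"
    \<comment> \<open>A geometric majorant: the term \<open>2\<close> at \<open>a = 0\<close> is
      corrected to \<open>1\<close>, and \<open>t\<close> cancels the term at \<open>a = 1\<close>
      when \<open>p\<close> lies in \<open>S\<close>.\<close>
    define h where "h a = 2 * (1 / real p) ^ a - (if a = 0 then 1 else 0) - (if a = 1 then t else 0)" for a :: nat
    have fh: "f (p ^ a) \<le> h a" for a
    proof (cases "a = 0")
      case True
      then show ?thesis using f by (simp add: h_def multiplicative_function_def)
    next
      case False
      then have "f (p ^ a) = (if p ^ a \<in> S then 0 else 2 / real p ^ a)"
        using p S by (simp add: f_def mu_star_prime_power prime_factorization_prime_power)
      then show ?thesis using False p2 by (auto simp: h_def t_def power_divide)
    qed
    have "h sums (2 * (1 / (1 - 1 / real p)) - 1 - t)"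
      unfolding h_def using p2 sums_single[of 0 "\<lambda>_. 1::real"] sums_single[of 1 "\<lambda>_. t"]
      by (intro sums_diff sums_mult geometric_sums) auto
    then have "(h has_sum (2 * (1 / (1 - 1 / real p)) - 1 - t)) UNIV"
      using fh f0 order_trans by (intro sums_nonneg_imp_has_sum) blast+
    then have h: "h summable_on UNIV" "infsum h UNIV = 2 * (1 / (1 - 1 / real p)) - 1 - t"
      by (auto simp: infsumI summable_on_def)
    have sf: "(\<lambda>a. f (p ^ a)) summable_on UNIV"
      using h(1) fh f0 by (rule summable_on_comparison_test)
    have "(\<Sum>\<^sub>\<infinity>a. f (p ^ a)) \<le> infsum h UNIV"
      using sf h(1) fh by (intro infsum_mono)
    \<comment> \<open>Here \<open>2 / (p - 1)\<close> is split as
      \<open>2 / p + 2 / (p * (p - 1))\<close>; then \<open>p - 1 \<ge> p / 2\<close> bounds the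
      last part.\<close>
    also have "\<dots> = 1 + (2 / real p - t) + 2 / (real p * (real p - 1))"
      using p2 unfolding h(2) by (simp add: field_simps)
    also have "2 / (real p * (real p - 1)) \<le> 2 / (real p * (real p / 2))"
      using p2 by (intro divide_left_mono mult_left_mono) auto
    also have "\<dots> = 4 / real p ^ 2" by (simp add: power2_eq_square)
    finally show ?thesis using sf by (auto simp: c_def t_def)
  qed
  have "(\<lambda>p. 2 * (1 / real p)) summable_on {p. prime p \<and> p \<notin> S}"
    by (rule summable_on_cmult_right[OF summ])
  then have "(\<lambda>p. if p \<in> S then 0 else 2 / real p) summable_on {p. prime p}"
    by (rule summable_on_cong_neutral[THEN iffD1, rotated -1]) auto
  moreover have "(\<lambda>p. 4 * (1 / real p ^ 2)) summable_on {p. prime p}"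
    by (rule summable_on_cmult_right[OF inverse_square_prime_summable])
  ultimately have c: "c summable_on {p. prime p}"
    unfolding c_def by (intro summable_on_add) simp_all
  have "(\<Sum>d = 1..N. f d) \<le> exp (infsum c {p. prime p})" for N
    using f f0 pow c by (intro sum_multiplicative_le_exp) (auto simp: c_def)
  then show ?thesis using that unfolding f_def by blast
qed

text \<open>The Landau symbols refer to \<open>x\<close> tending to infinity, so the vanishing of
  \<open>ln x\<close> at \<open>1\<close> does no harm and powers of \<open>1 + ln x\<close> are
  absorbed.\<close>

lemma bigo_of_bound:
  fixes f g h :: "real \<Rightarrow> real"
  assumes "\<And>x. x \<ge> 1 \<Longrightarrow> \<bar>f x\<bar> \<le> g x" "g \<in> O(h)"
  shows "f \<in> O(h)"
proof (rule landau_o.big_trans[OF _ assms(2)])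
  show "f \<in> O(g)"
    using assms(1) by (intro bigoI[where c = 1] eventually_at_top_linorderI[of 1]) force
qed

section \<open>Euler product of the density\<close>

lemma totient_prime_power_div:
  assumes "prime p" "a > 0"
  shows "real (totient (p ^ a)) ^ k / real (p ^ a) ^ (2 * k) = (1 - 1 / real p) ^ k * (1 / real p ^ (a * k))"
proof -
  have "real (p ^ a) > 0" using prime_gt_0_nat[OF assms(1)] by simp
  moreover have "real (totient (p ^ a)) = real (p ^ a) * (1 - 1 / real p)"
    using assms by (simp add: totient_formula2 prime_factorization_prime_power)
  ultimately have "real (totient (p ^ a)) ^ k / real (p ^ a) ^ (2 * k) = (1 - 1 / real p) ^ k * (1 / real (p ^ a) ^ k)"
    by (simp only: power_mult_distrib mult_2 power_add) simp
  then show ?thesis by (simp add: power_mult)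
qed

text \<open>The terms of the series are multiplicative. At \<open>p ^ a\<close> with
  \<open>a \<ge> 1\<close>, \<open>mu_star\<close> is \<open>-1\<close> if the power lies outside
  \<open>S\<close> and \<open>0\<close> otherwise, so only the exponents with \<open>p ^ a\<close>
  outside \<open>S\<close> contribute to the local factor.\<close>

lemma delta_has_prod:
  assumes k: "k \<ge> 2" and S: "multiplicative_set S"
  shows "(\<lambda>p::nat. if prime p
             then 1 - (1 - 1 / real p) ^ k *
                    (\<Sum>\<^sub>\<infinity>a\<in>{a. a \<ge> 1 \<and> p ^ a \<notin> S}. 1 / real p ^ (a * k))
             else 1) has_prod delta k S"
proof -
  have f: "multiplicative_function (delta_term k S)"
    unfolding delta_term_def
    by (intro multiplicative_function_divide multiplicative_function_mult multiplicative_function_power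
        multiplicative_function_mu_star[OF S] multiplicative_function_totient multiplicative_function_of_nat)
  have summ: "(\<lambda>d. \<bar>delta_term k S d\<bar>) summable_on {0<..}"
    by (rule delta_term_summable[OF abs_mu_star_summable[OF k]])
  have delta: "delta k S = infsum (delta_term k S) {0<..}"
    using suminf_Suc_eq_infsum[OF summable_on_abs_imp[OF summ]] by (simp add: delta_def)
  have "(\<Sum>\<^sub>\<infinity>a. delta_term k S (p ^ a)) =
      1 - (1 - 1 / real p) ^ k * (\<Sum>\<^sub>\<infinity>a\<in>{a. a \<ge> 1 \<and> p ^ a \<notin> S}. 1 / real p ^ (a * k))"
    if p: "prime p" for p
  proof -
    have "(\<Sum>\<^sub>\<infinity>a. delta_term k S (p ^ a)) = 1 + (\<Sum>\<^sub>\<infinity>a\<in>{0<..}. delta_term k S (p ^ a))"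
      by (rule infsum_prime_powers[OF f summable_on_abs_imp[OF abs_summable_on_prime_powers[OF summ p]]])
    also have "(\<Sum>\<^sub>\<infinity>a\<in>{0<..}. delta_term k S (p ^ a)) =
        (\<Sum>\<^sub>\<infinity>a\<in>{a. a \<ge> 1 \<and> p ^ a \<notin> S}. - ((1 - 1 / real p) ^ k) * (1 / real p ^ (a * k)))"
    proof (rule infsum_cong_neutral)
      fix a assume "a \<in> {0<..} - {a. a \<ge> 1 \<and> p ^ a \<notin> S}"
      then show "delta_term k S (p ^ a) = 0"
        using mu_star_prime_power[OF S p, of a] by (auto simp: delta_term_def)
    next
      fix a assume "a \<in> {0<..} \<inter> {a. a \<ge> 1 \<and> p ^ a \<notin> S}"
      then have "a > 0" "mu_star S (p ^ a) = -1"
        using mu_star_prime_power[OF S p, of a] by auto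
      then show "delta_term k S (p ^ a) = - ((1 - 1 / real p) ^ k) * (1 / real p ^ (a * k))"
        using totient_prime_power_div[OF p, of a k] unfolding delta_term_def by simp
    qed auto
    also have "\<dots> = - ((1 - 1 / real p) ^ k) * (\<Sum>\<^sub>\<infinity>a\<in>{a. a \<ge> 1 \<and> p ^ a \<notin> S}. 1 / real p ^ (a * k))"
      by (rule infsum_cmult_right')
    finally show ?thesis by simp
  qed
  then show ?thesis
    using has_prod_euler_product[OF f summ] unfolding delta by (simp cong: if_cong)
qed

text \<open>For \<open>S = {1}\<close> every exponent \<open>a \<ge> 1\<close> contributes, and the
  inner sum is the geometric series with value \<open>1 / (p ^ k - 1)\<close>.\<close>

lemma delta_one_has_prod:
  assumes k: "k \<ge> 2"
  shows "(\<lambda>p::nat. if prime p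
           then 1 - (real p - 1) ^ k / (real p ^ k * (real p ^ k - 1))
           else 1) has_prod delta k {1}"
proof -
  have "(1 - 1 / real p) ^ k * (\<Sum>\<^sub>\<infinity>a\<in>{a. a \<ge> 1 \<and> p ^ a \<notin> {1}}. 1 / real p ^ (a * k)) =
      (real p - 1) ^ k / (real p ^ k * (real p ^ k - 1))" if p: "prime p" for p :: nat
  proof -
    have p2: "real p \<ge> 2" using prime_ge_2_nat[OF p] by simp
    define q where "q = real p ^ k"
    have q: "q > 1" unfolding q_def using p2 k by (intro one_less_power) auto
    have "(\<lambda>n. 1 / q * (1 / q) ^ n) sums (1 / q * (1 / (1 - 1 / q)))"
      using q by (intro sums_mult geometric_sums) auto
    then have "(\<lambda>n. 1 / q ^ Suc n) sums (1 / (q - 1))"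
      using q by (simp add: power_divide field_simps)
    then have "((\<lambda>n. 1 / q ^ Suc n) has_sum (1 / (q - 1))) UNIV"
      using q by (intro sums_nonneg_imp_has_sum) auto
    moreover have "bij_betw Suc UNIV {0<..}"
      by (rule bij_betwI[of _ _ _ "\<lambda>n. n - 1"]) auto
    ultimately have "((\<lambda>a. 1 / q ^ a) has_sum (1 / (q - 1))) {0<..}"
      by (subst (asm) has_sum_reindex_bij_betw)
    then have "(\<Sum>\<^sub>\<infinity>a\<in>{0<..}. 1 / q ^ a) = 1 / (q - 1)" by (rule infsumI)
    moreover have "{a. a \<ge> 1 \<and> p ^ a \<notin> {1}} = {0<..}" using p by auto
    moreover have "real p ^ (a * k) = q ^ a" for a
      by (simp add: q_def power_mult[symmetric] mult.commute)
    ultimately have "(\<Sum>\<^sub>\<infinity>a\<in>{a. a \<ge> 1 \<and> p ^ a \<notin> {1}}. 1 / real p ^ (a * k)) = 1 / (q - 1)" by simp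
    moreover have "1 - 1 / real p = (real p - 1) / real p" using p2 by (simp add: field_simps)
    then have "(1 - 1 / real p) ^ k = (real p - 1) ^ k / q" by (simp add: q_def power_divide)
    ultimately show ?thesis by (simp add: q_def)
  qed
  moreover have "multiplicative_set {1}"
    by (auto simp: multiplicative_set_def indicator_def)
  ultimately show ?thesis
    using delta_has_prod[OF k, of "{1}"] by (simp cong: if_cong)
qed

theorem theorem2p1:
  fixes k :: nat and S :: "nat set"
  assumes "k \<ge> 2" and "S \<subseteq> {1..}"
  shows "summable (\<lambda>n. delta_term k S (Suc n))
    \<and> (\<forall>x\<ge>1. real (gcud_count k x S) = delta k S * x ^ k + V k x S)
    \<and> (k > 2 \<longrightarrow> (\<lambda>x. V k x S) \<in> O(\<lambda>x. x ^ (k - 1)))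
    \<and> (\<lambda>x. V 2 x S) \<in> O(\<lambda>x. x * ln x ^ 4)
    \<and> ((\<lambda>n. real (theta n) / real n) summable_on S
          \<longrightarrow> (\<lambda>x. V 2 x S) \<in> O(\<lambda>x. x * ln x ^ 2))
    \<and> (finite S \<longrightarrow> (\<lambda>x. V 2 x S) \<in> O(\<lambda>x. x * ln x ^ 2))
    \<and> (multiplicative_set S \<longrightarrow> (\<lambda>x. V 2 x S) \<in> O(\<lambda>x. x * ln x ^ 2))
    \<and> (multiplicative_set S \<longrightarrow> (\<lambda>p. 1 / real p) summable_on {p. prime p \<and> p \<notin> S}
          \<longrightarrow> (\<lambda>x. V 2 x S) \<in> O(\<lambda>x. x))
    \<and> (multiplicative_set S \<longrightarrow> finite {p. prime p \<and> p \<notin> S}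
          \<longrightarrow> (\<lambda>x. V 2 x S) \<in> O(\<lambda>x. x))
    \<and> (multiplicative_set S \<longrightarrow>
          (\<lambda>p::nat. if prime p
             then 1 - (1 - 1 / real p) ^ k *
                    (\<Sum>\<^sub>\<infinity>a\<in>{a. a \<ge> 1 \<and> p ^ a \<notin> S}. 1 / real p ^ (a * k))
             else 1) has_prod delta k S)
    \<and> (\<lambda>p::nat. if prime p
           then 1 - (real p - 1) ^ k / (real p ^ k * (real p ^ k - 1))
           else 1) has_prod delta k {1}"
proof (intro conjI impI)
  show "summable (\<lambda>n. delta_term k S (Suc n))"
    by (rule suminf_Suc_eq_infsum(1)[OF summable_on_abs_imp[OF delta_term_summable[OF
          abs_mu_star_summable[OF assms(1)]]]])
  show "\<forall>x\<ge>1. real (gcud_count k x S) = delta k S * x ^ k + V k x S"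
    by (simp add: V_def)
  show "(\<lambda>x. V k x S) \<in> O(\<lambda>x. x ^ (k - 1))" if "k > 2"
    using V_bound_gt_2[OF that] by (rule bigo_of_bound) simp_all
  show "(\<lambda>x. V 2 x S) \<in> O(\<lambda>x. x * ln x ^ 4)"
    by (rule bigo_of_bound[OF V2_bound[OF _ sum_mu_star_omega_le_ln4]]) (assumption | real_asymp)+
  have theta: "(\<lambda>x. V 2 x S) \<in> O(\<lambda>x. x * ln x ^ 2)" if "(\<lambda>n. real (theta n) / real n) summable_on S"
  proof (rule bigo_of_bound[OF V2_bound[OF _ sum_mu_star_omega_theta[OF assms(2) that]]])
    \<comment> \<open>The sum over \<open>S\<close> does not depend on \<open>x\<close>, so the
      asymptotics are established for an arbitrary constant.\<close>
    have "(\<lambda>x. 2 * x * (C * (1 + ln x) ^ 2) + x * (4 * ln x + 12)) \<in> O(\<lambda>x. x * ln x ^ 2)" for C :: real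
      by real_asymp
    then show "(\<lambda>x. 2 * x * (infsum (\<lambda>n. real (theta n) / real n) S * (1 + ln x) ^ 2) + x * (4 * ln x + 12))
        \<in> O(\<lambda>x. x * ln x ^ 2)" .
  qed
  then show "(\<lambda>x. V 2 x S) \<in> O(\<lambda>x. x * ln x ^ 2)" if "(\<lambda>n. real (theta n) / real n) summable_on S"
    using that .
  show "(\<lambda>x. V 2 x S) \<in> O(\<lambda>x. x * ln x ^ 2)" if "finite S"
    using that by (intro theta) simp
  show "(\<lambda>x. V 2 x S) \<in> O(\<lambda>x. x * ln x ^ 2)" if S: "multiplicative_set S"
    by (rule bigo_of_bound[OF V2_bound_multiplicative[OF S _ sum_mu_star_omega_multiplicative[OF S]]])
      (assumption | real_asymp)+
  have primes: "(\<lambda>x. V 2 x S) \<in> O(\<lambda>x. x)"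
    if S: "multiplicative_set S" and summ: "(\<lambda>p. 1 / real p) summable_on {p. prime p \<and> p \<notin> S}"
  proof -
    obtain C where "\<And>N. (\<Sum>d = 1..N. \<bar>mu_star S d\<bar> * 2 ^ card (prime_factors d) / real d) \<le> C"
      using sum_mu_star_omega_primes[OF S summ] by blast
    from V2_bound_multiplicative[OF S _ this] show ?thesis
      by (rule bigo_of_bound) (assumption | real_asymp)+
  qed
  then show "(\<lambda>x. V 2 x S) \<in> O(\<lambda>x. x)"
    if "multiplicative_set S" "(\<lambda>p. 1 / real p) summable_on {p. prime p \<and> p \<notin> S}"
    using that .
  show "(\<lambda>x. V 2 x S) \<in> O(\<lambda>x. x)"
    if "multiplicative_set S" "finite {p. prime p \<and> p \<notin> S}"
    using that by (intro primes) simp_all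
qed (use delta_has_prod delta_one_has_prod assms(1) in blast)+

end
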